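(* There is a randomized algorithm that decides the $(n-k)$-DV problem using $O^*(2^{k+s})$ evaluations of the input polynomial $P$ and with negligible probability of a false negative, where $s\le k$ is the minimum, taken over all monomials of $P$ with at most $n-k$ distinct indeterminates, of the number of indeterminates appearing in that monomial with degree greater than $1$.
   Context: The $(n-k)$-DV problem: given a polynomial $P\in\mathbb{Z}[y_1,y_2,\ldots,y_n]$ that is homogeneous of degree $n$ and has nonnegative integer coefficients (accessed via evaluations), and an integer $k$, decide whether $P$ has a monomial (with nonzero coefficient) containing at most $n-k$ distinct indeterminates. The notation $O^*(\cdot)$ suppresses a factor polynomial in the input size. Negligible probability means probability tending to zero as $n\to\infty$. *)

theory Defs
  imports
    Complex_Main
    "HOL-Library.Poly_Mapping"
    "HOL-Computational_Algebra.Polynomial"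
    "HOL-Probability.SPMF"
begin

section \<open>Multivariate integer polynomials and the problem\<close>

text \<open>A monomial maps each indeterminate (indexed from 0) to its exponent; a polynomial maps
  each monomial to its coefficient, so that
  \<^term>\<open>Poly_Mapping.keys P\<close> is the set of monomials with nonzero coefficient.\<close>

type_synonym monom = "nat \<Rightarrow>\<^sub>0 nat"
type_synonym int_mpoly = "monom \<Rightarrow>\<^sub>0 int"

definition monom_degree :: "monom \<Rightarrow> nat" where
  "monom_degree m = (\<Sum>i\<in>Poly_Mapping.keys m. Poly_Mapping.lookup m i)"

definition in_variables :: "nat \<Rightarrow> int_mpoly \<Rightarrow> bool" where
  "in_variables n P \<longleftrightarrow> (\<forall>m\<in>Poly_Mapping.keys P. Poly_Mapping.keys m \<subseteq> {..<n})"

definition homogeneous :: "nat \<Rightarrow> int_mpoly \<Rightarrow> bool" where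
  "homogeneous d P \<longleftrightarrow> (\<forall>m\<in>Poly_Mapping.keys P. monom_degree m = d)"

definition eval_mpoly :: "int_mpoly \<Rightarrow> (nat \<Rightarrow> int) \<Rightarrow> int" where
  "eval_mpoly P y = (\<Sum>m\<in>Poly_Mapping.keys P.
    Poly_Mapping.lookup P m * (\<Prod>i\<in>Poly_Mapping.keys m. y i ^ Poly_Mapping.lookup m i))"

definition DV_instance :: "nat \<Rightarrow> int_mpoly \<Rightarrow> bool" where
  "DV_instance n P \<longleftrightarrow> in_variables n P \<and> homogeneous n P \<and>
    (\<forall>m. Poly_Mapping.lookup P m \<ge> 0)"

text \<open>The bound \<open>n - k\<close> is written additively because subtraction on \<^typ>\<open>nat\<close> truncates.\<close>

definition DV_monomials :: "nat \<Rightarrow> nat \<Rightarrow> int_mpoly \<Rightarrow> monom set" where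
  "DV_monomials n k P = {m \<in> Poly_Mapping.keys P. card (Poly_Mapping.keys m) + k \<le> n}"

definition DV :: "nat \<Rightarrow> nat \<Rightarrow> int_mpoly \<Rightarrow> bool" where
  "DV n k P \<longleftrightarrow> DV_monomials n k P \<noteq> {}"

definition repeated :: "monom \<Rightarrow> nat" where
  "repeated m = card {i. Poly_Mapping.lookup m i > 1}"

text \<open>The parameter \<open>s\<close>. The minimum itself may exceed \<open>k\<close> (for \<open>n = 4\<close>, \<open>k = 1\<close> and the single
  monomial with exponents \<open>(2,2,0,0)\<close> it is 2), and it is undefined on negative instances;
  including \<open>k\<close> enforces \<open>s \<le> k\<close> and gives \<open>s = k\<close> on negative instances.\<close>

definition DV_s :: "nat \<Rightarrow> nat \<Rightarrow> int_mpoly \<Rightarrow> nat" where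
  "DV_s n k P = Min (insert k (repeated ` DV_monomials n k P))"


section \<open>Randomized algorithms with evaluation access to a polynomial\<close>

text \<open>Algorithms are programs of a while-language over unbounded integers. Every variable is an
  array; scalars are kept at index 0. Beyond assignment, a program can toss a fair coin and
  query the polynomial: \<open>Query x a\<close> stores in the scalar \<open>x\<close> the value of the
  polynomial at the point \<open>(a[0], \<dots>, a[n-1])\<close>.\<close>

type_synonym vname = string
type_synonym store = "vname \<Rightarrow> int \<Rightarrow> int"

datatype aexp = Num int | Cell vname aexp
  | Plus aexp aexp | Minus aexp aexp | Times aexp aexp | Div aexp aexp | Mod aexp aexp

datatype bexp = Less aexp aexp | Not bexp | And bexp bexp

datatype com = Skip | Assign vname aexp aexp | Flip vname | Query vname vname
  | Seq com com | If bexp com com | While bexp com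

primrec aval :: "aexp \<Rightarrow> store \<Rightarrow> int" where
  "aval (Num c) \<sigma> = c"
| "aval (Cell x e) \<sigma> = \<sigma> x (aval e \<sigma>)"
| "aval (Plus e f) \<sigma> = aval e \<sigma> + aval f \<sigma>"
| "aval (Minus e f) \<sigma> = aval e \<sigma> - aval f \<sigma>"
| "aval (Times e f) \<sigma> = aval e \<sigma> * aval f \<sigma>"
| "aval (Div e f) \<sigma> = aval e \<sigma> div aval f \<sigma>"
| "aval (Mod e f) \<sigma> = aval e \<sigma> mod aval f \<sigma>"

primrec bval :: "bexp \<Rightarrow> store \<Rightarrow> bool" where
  "bval (Less e f) \<sigma> \<longleftrightarrow> aval e \<sigma> < aval f \<sigma>"
| "bval (Not b) \<sigma> \<longleftrightarrow> \<not> bval b \<sigma>"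
| "bval (And b c) \<sigma> \<longleftrightarrow> bval b \<sigma> \<and> bval c \<sigma>"

definition store_upd :: "store \<Rightarrow> vname \<Rightarrow> int \<Rightarrow> int \<Rightarrow> store" where
  "store_upd \<sigma> x i v = \<sigma>(x := (\<sigma> x)(i := v))"

definition query_point :: "nat \<Rightarrow> store \<Rightarrow> vname \<Rightarrow> nat \<Rightarrow> int" where
  "query_point n \<sigma> a = (\<lambda>i. if i < n then \<sigma> a (int i) else 0)"

partial_function (spmf) while_spmf :: "('a \<Rightarrow> bool) \<Rightarrow> ('a \<Rightarrow> 'a spmf) \<Rightarrow> 'a \<Rightarrow> 'a spmf" where
  "while_spmf b f x = (if b x then bind_spmf (f x) (while_spmf b f) else return_spmf x)"

text \<open>A configuration is a store together with the list of all points queried so far.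
  Nontermination shows up as missing probability mass.\<close>

type_synonym config = "store \<times> (nat \<Rightarrow> int) list"

primrec exec :: "nat \<Rightarrow> int_mpoly \<Rightarrow> com \<Rightarrow> config \<Rightarrow> config spmf" where
  "exec n P Skip = return_spmf"
| "exec n P (Assign x e f) =
    (\<lambda>(\<sigma>, qs). return_spmf (store_upd \<sigma> x (aval e \<sigma>) (aval f \<sigma>), qs))"
| "exec n P (Flip x) =
    (\<lambda>(\<sigma>, qs). map_spmf (\<lambda>b. (store_upd \<sigma> x 0 (of_bool b), qs)) coin_spmf)"
| "exec n P (Query x a) =
    (\<lambda>(\<sigma>, qs). let y = query_point n \<sigma> a
      in return_spmf (store_upd \<sigma> x 0 (eval_mpoly P y), y # qs))"
| "exec n P (Seq c d) = (\<lambda>cfg. bind_spmf (exec n P c cfg) (exec n P d))"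
| "exec n P (If b c d) =
    (\<lambda>cfg. if bval b (fst cfg) then exec n P c cfg else exec n P d cfg)"
| "exec n P (While b c) = while_spmf (\<lambda>cfg. bval b (fst cfg)) (exec n P c)"

definition initial_store :: "nat \<Rightarrow> nat \<Rightarrow> store" where
  "initial_store n k = store_upd (store_upd (\<lambda>_ _. 0) ''n'' 0 (int n)) ''k'' 0 (int k)"

text \<open>The joint distribution of the verdict and the list of queried points. The program is
  given \<open>n\<close> and \<open>k\<close>; it learns about \<open>P\<close> only through queries, and it is not given \<open>s\<close>.\<close>

definition run :: "com \<Rightarrow> nat \<Rightarrow> nat \<Rightarrow> int_mpoly \<Rightarrow> (bool \<times> (nat \<Rightarrow> int) list) spmf" where
  "run A n k P =
    map_spmf (\<lambda>(\<sigma>, qs). (\<sigma> ''accept'' 0 \<noteq> 0, qs)) (exec n P A (initial_store n k, []))"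

end

theory Submission
  imports Defs "HOL-Library.Nat_Bijection"
begin

text \<open>
  The algorithm is deterministic. Fix a set \<open>B\<close> of indeterminates, set those in \<open>B\<close> to 1 and the
  others to \<open>z\<close>. The resulting univariate polynomial has degree at least \<open>n - |B| + k\<close> iff \<open>P\<close> has a
  monomial \<open>m\<close> whose exponents satisfy \<open>(\<Sum>i\<in>B. 1 - m i) \<ge> k\<close>, and such a monomial misses at least
  \<open>k\<close> indeterminates. Since coefficients are nonnegative, the degree is tested without cancellation by
  one iterated finite difference at 0, that is, by at most \<open>2n + 1\<close> queries.

  Conversely, let \<open>m\<close> miss \<open>k\<close> indeterminates, let \<open>s\<close> of its exponents exceed 1 and put
  \<open>t = min s k\<close>. If \<open>B\<close> contains \<open>k\<close> fixed missing indeterminates and avoids \<open>t\<close> fixed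
  repeated ones, then \<open>B\<close> or the set obtained from \<open>B\<close> by complementing on the remaining indeterminates
  satisfies the inequality. So a fraction \<open>\<ge> 1 / 2 ^ (k + t + 1)\<close> of all \<open>B\<close> detects \<open>m\<close>, and by the
  greedy covering argument some family of \<open>2 ^ (k + t + 1) * (n\<^sup>2 + 1)\<close> sets detects every exponent vector
  of this density. Only queries are counted, so the program may find such a family by exhaustive
  search. It does so for \<open>t = 0, 1, \<dots>, k\<close> until it accepts; as the family cannot miss, a run never
  goes beyond the unknown value \<open>t = min s k\<close>, which is what bounds its number of queries.
\<close>

subsection \<open>Finite differences of powers\<close>

text \<open>The \<open>r\<close>-th difference of \<open>x ^ d\<close> at 0, which counts surjections from \<open>d\<close> to \<open>r\<close> elements.\<close>

definition surj_sum :: "nat \<Rightarrow> nat \<Rightarrow> int" where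
  "surj_sum d r = (\<Sum>j\<le>r. (-1) ^ (r + j) * int (r choose j) * int j ^ d)"

lemma surj_sum_0_right: "surj_sum d 0 = of_bool (d = 0)"
  by (simp add: surj_sum_def)

lemma surj_sum_0_left: "surj_sum 0 r = of_bool (r = 0)"
proof -
  have "surj_sum 0 r = (-1) ^ r * (\<Sum>j\<le>r. (-1) ^ j * int (r choose j))"
    by (simp add: surj_sum_def sum_distrib_left power_add mult.assoc)
  then show ?thesis
    by (cases "r = 0") (simp_all add: choose_alternating_sum)
qed

lemma choose_Suc_mult: "(r choose Suc j) * Suc j = (r choose j) * (r - j)"
proof (cases r)
  case (Suc r')
  then show ?thesis
    using Suc_times_binomial_eq[of r' j] binomial_absorb_comp[of r j] by (simp add: mult.commute)
qed simp

text \<open>For surjections: the last element has \<open>Suc r\<close> possible images, and the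
  remaining \<open>d\<close> elements cover either all values or all values but that one. The proof
  absorbs one factor \<open>j\<close> of the power into the binomial coefficient, writing
  \<open>j * (Suc r choose j)\<close> as \<open>Suc r\<close> times a difference of two
  binomials.\<close>

lemma surj_sum_Suc_Suc:
  "surj_sum (Suc d) (Suc r) = int (Suc r) * (surj_sum d (Suc r) + surj_sum d r)"
proof -
  have *: "int (Suc r choose j) * int j = int (Suc r) * (int (Suc r choose j) - int (r choose j))"
    if "j \<le> Suc r" for j
  proof -
    have "(Suc r - j) * (Suc r choose j) = Suc r * (r choose j)"
      using binomial_absorb_comp[of "Suc r" j] by simp
    then have "int (Suc r - j) * int (Suc r choose j) = int (Suc r) * int (r choose j)"
      by (metis of_nat_mult)
    then show ?thesis
      using that by (simp add: of_nat_diff algebra_simps)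
  qed
  have "surj_sum (Suc d) (Suc r) =
      (\<Sum>j\<le>Suc r. (-1) ^ (Suc r + j) * (int (Suc r choose j) * int j) * int j ^ d)"
    by (simp add: surj_sum_def mult_ac)
  also have "\<dots> = (\<Sum>j\<le>Suc r. (-1) ^ (Suc r + j) *
      (int (Suc r) * (int (Suc r choose j) - int (r choose j))) * int j ^ d)"
    by (rule sum.cong) (use * in auto)
  also have "\<dots> = int (Suc r) * (surj_sum d (Suc r) -
      (\<Sum>j\<le>Suc r. (-1) ^ (Suc r + j) * int (r choose j) * int j ^ d))"
    unfolding surj_sum_def sum_subtractf[symmetric] sum_distrib_left
    by (rule sum.cong) (auto simp: algebra_simps simp del: of_nat_Suc)
  also have "(\<Sum>j\<le>Suc r. (-1) ^ (Suc r + j) * int (r choose j) * int j ^ d) = - surj_sum d r"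
    by (simp add: surj_sum_def sum_negf)
  finally show ?thesis by simp
qed

text \<open>The recurrence has only positive coefficients, so signs propagate by induction. The
  clause for \<open>r = 0\<close> reflects that only the empty set maps to the empty set.\<close>

lemma surj_sum_nonneg_pos: "surj_sum d r \<ge> 0 \<and> (surj_sum d r > 0 \<longleftrightarrow> r \<le> d \<and> (r = 0 \<longrightarrow> d = 0))"
proof (induction d arbitrary: r)
  case 0
  then show ?case by (simp add: surj_sum_0_left)
next
  case (Suc d)
  show ?case
  proof (cases r)
    case 0
    then show ?thesis by (simp add: surj_sum_0_right)
  next
    case (Suc r')
    have "surj_sum d r \<ge> 0" "surj_sum d r' \<ge> 0" using Suc.IH by auto
    moreover have "surj_sum d r > 0 \<or> surj_sum d r' > 0 \<longleftrightarrow> r' \<le> d"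
      using Suc.IH[of r] Suc.IH[of r'] Suc by auto
    ultimately show ?thesis
      using Suc by (auto simp: surj_sum_Suc_Suc zero_less_mult_iff)
  qed
qed

subsection \<open>Sets that detect an exponent vector\<close>

text \<open>Sets are coded by their binary digits, exponent vectors in base \<open>n + 1\<close>, and families of sets
  in base \<open>2 ^ n\<close>.\<close>

definition digit :: "nat \<Rightarrow> nat \<Rightarrow> nat \<Rightarrow> nat" where
  "digit d c i = c div d ^ i mod d"

lemma digit_Suc: "digit d c (Suc i) = digit d (c div d) i"
  by (simp add: digit_def div_mult2_eq mult.commute)

lemma ex_digits:
  assumes "\<And>i. i < n \<Longrightarrow> f i < d"
  shows "\<exists>c < d ^ n. \<forall>i<n. digit d c i = f i"
  using assms
proof (induction n arbitrary: f)
  case (Suc n)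
  from Suc.IH[of "\<lambda>i. f (Suc i)"] obtain c
    where c: "c < d ^ n" "\<And>i. i < n \<Longrightarrow> digit d c i = f (Suc i)"
    using Suc.prems by auto
  have f0: "f 0 < d" using Suc.prems by simp
  have "c * d + f 0 < d ^ Suc n"
  proof -
    have "c * d + f 0 < Suc c * d" using f0 by simp
    also have "\<dots> \<le> d ^ n * d" by (rule mult_right_mono) (use c in auto)
    finally show ?thesis by (simp add: mult.commute)
  qed
  moreover have "digit d (c * d + f 0) i = f i" if "i < Suc n" for i
  proof (cases i)
    case 0
    then show ?thesis using f0 by (simp add: digit_def)
  next
    case (Suc i')
    then show ?thesis using c that f0 by (simp add: digit_Suc)
  qed
  ultimately show ?case by blast
qed simp

lemma digit_2: "digit 2 b i = of_bool (i \<in> set_decode b)"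
  by (auto simp: digit_def set_decode_def odd_iff_mod_2_eq_one)

lemma bij_betw_set_decode: "bij_betw set_decode {..<2 ^ n} (Pow {..<n})"
proof (rule bij_betw_byWitness[where f' = set_encode])
  show "\<forall>A\<in>Pow {..<n}. set_decode (set_encode A) = A"
    by (auto intro!: set_encode_inverse intro: finite_subset)
  have "i < n" if "i \<in> set_decode b" "b < 2 ^ n" for i b
  proof (rule ccontr)
    assume "\<not> i < n"
    then have "(2::nat) ^ n \<le> 2 ^ i" by simp
    then have "b < 2 ^ i" using that(2) by linarith
    then have "b div 2 ^ i = 0" by simp
    then show False using that(1) by (simp add: set_decode_def)
  qed
  then show "set_decode ` {..<2 ^ n} \<subseteq> Pow {..<n}" by auto
  have "set_encode A < 2 ^ n" if "A \<subseteq> {..<n}" for A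
  proof -
    have "set_encode A \<le> set_encode {..<n}"
      unfolding set_encode_def by (rule sum_mono2) (use that in auto)
    also have "\<dots> < 2 ^ n"
      by (induction n) (auto simp: set_encode_def lessThan_Suc)
    finally show ?thesis .
  qed
  then show "set_encode ` Pow {..<n} \<subseteq> {..<2 ^ n}" by auto
qed simp

text \<open>If the entries of \<open>e\<close> sum to \<open>n\<close>, this is the amount by which
  the degree outside the set coded by \<open>b\<close> exceeds the number of indeterminates outside
  it. Hence it measures whether the univariate restriction has large degree.\<close>

definition balance :: "nat \<Rightarrow> (nat \<Rightarrow> nat) \<Rightarrow> nat \<Rightarrow> int" where
  "balance n e b = (\<Sum>i<n. int (digit 2 b i) * (1 - int (e i)))"

lemma balance_eq: 
  assumes "b < 2 ^ n"
  shows "balance n e b = (\<Sum>i\<in>set_decode b. 1 - int (e i))"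
proof -
  have "set_decode b \<subseteq> {..<n}"
    using bij_betw_set_decode[of n] assms by (auto simp: bij_betw_def)
  then have "(\<Sum>i\<in>set_decode b. 1 - int (e i)) =
      (\<Sum>i<n. if i \<in> set_decode b then 1 - int (e i) else 0)"
    by (simp add: sum.inter_restrict[symmetric] Int_absorb1)
  also have "\<dots> = balance n e b"
    unfolding balance_def digit_2 by (rule sum.cong) auto
  finally show ?thesis by simp
qed

section \<open>Counting the sets of large balance\<close>

lemma card_balance:
  "card {b. b < 2 ^ n \<and> int k \<le> balance n e b} =
   card {B \<in> Pow {..<n}. int k \<le> (\<Sum>i\<in>B. 1 - int (e i))}"
proof (rule bij_betw_same_card[of set_decode])
  have "bij_betw set_decode {b \<in> {..<2 ^ n}. int k \<le> balance n e b}
      (set_decode ` {b \<in> {..<2 ^ n}. int k \<le> balance n e b})"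
    using bij_betw_set_decode[of n] by (rule bij_betw_subset) auto
  moreover have "set_decode ` {b \<in> {..<2 ^ n}. int k \<le> balance n e b} =
      {B \<in> set_decode ` {..<2 ^ n}. int k \<le> (\<Sum>i\<in>B. 1 - int (e i))}"
    by (auto simp: balance_eq)
  moreover have "set_decode ` {..<2 ^ n} = Pow {..<n}"
    by (rule bij_betw_imp_surj_on[OF bij_betw_set_decode])
  ultimately show "bij_betw set_decode {b. b < 2 ^ n \<and> int k \<le> balance n e b}
      {B \<in> Pow {..<n}. int k \<le> (\<Sum>i\<in>B. 1 - int (e i))}"
    by simp
qed

text \<open>The sums over \<open>B\<close> and \<open>C - B\<close> add up to a nonnegative number,
  so one of the two is nonnegative. Thus the good sets and their complements cover the power
  set.\<close>

lemma card_subsets_sum_nonneg: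
  fixes x :: "'a \<Rightarrow> int"
  assumes "finite C" "sum x C \<ge> 0"
  shows "2 ^ card C \<le> 2 * card {B \<in> Pow C. sum x B \<ge> 0}"
proof -
  let ?S = "{B \<in> Pow C. sum x B \<ge> 0}"
  have "B \<in> ?S \<union> (\<lambda>B. C - B) ` ?S" if "B \<in> Pow C" for B
  proof (cases "sum x B \<ge> 0")
    case False
    have "sum x C = sum x (C - B) + sum x B"
      using that assms(1) by (intro sum.subset_diff) auto
    then have "C - B \<in> ?S" using False assms(2) by auto
    moreover have "B = C - (C - B)" using that by auto
    ultimately show ?thesis by blast
  qed (use that in auto)
  then have "Pow C \<subseteq> ?S \<union> (\<lambda>B. C - B) ` ?S" by blast
  then have "card (Pow C) \<le> card (?S \<union> (\<lambda>B. C - B) ` ?S)"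
    using assms(1) by (intro card_mono) auto
  also have "\<dots> \<le> card ?S + card ((\<lambda>B. C - B) ` ?S)" by (rule card_Un_le)
  also have "\<dots> \<le> card ?S + card ?S" 
    using assms(1) by (intro add_left_mono card_image_le) auto
  finally show ?thesis using assms(1) by (simp add: card_Pow)
qed

text \<open>Force \<open>M\<close> into the set and \<open>R\<close> out of it. The rest
  \<open>D\<close> then has nonnegative total weight, so at least half of its subsets keep the sum
  at \<open>k\<close> or more. The forced choices cost \<open>2 ^ (card M + card R)\<close>, the
  halving one more factor 2.\<close>

lemma card_subsets_balanced:
  fixes x :: "'a \<Rightarrow> int"
  assumes "finite C" "M \<subseteq> C" "R \<subseteq> C" "M \<inter> R = {}"
    and "sum x C = 0" "sum x M = k" "sum x R \<le> - k"
  shows "2 ^ card C \<le> 2 ^ (card M + card R + 1) * card {B \<in> Pow C. k \<le> sum x B}"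
proof -
  define D where "D = C - (M \<union> R)"
  have fin: "finite M" "finite R" "finite D"
    using assms finite_subset unfolding D_def by auto
  have C: "C = M \<union> R \<union> D" "M \<inter> D = {}" "R \<inter> D = {}"
    using assms by (auto simp: D_def)
  have "sum x C = sum x M + sum x R + sum x D"
    using fin C assms(4) by (simp add: sum.union_disjoint Int_Un_distrib2)
  then have "sum x D \<ge> 0" using assms by linarith
  then have *: "2 ^ card D \<le> 2 * card {B \<in> Pow D. sum x B \<ge> 0}"
    using fin(3) by (intro card_subsets_sum_nonneg)
  have "card {B \<in> Pow D. sum x B \<ge> 0} = card ((\<lambda>B. M \<union> B) ` {B \<in> Pow D. sum x B \<ge> 0})"
    by (rule card_image[symmetric]) (use C in \<open>auto simp: inj_on_def\<close>)
  also have "\<dots> \<le> card {B \<in> Pow C. k \<le> sum x B}"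
  proof (rule card_mono)
    have "k \<le> sum x (M \<union> B)" if "B \<subseteq> D" "sum x B \<ge> 0" for B
    proof -
      have "sum x (M \<union> B) = sum x M + sum x B"
        using that fin C by (intro sum.union_disjoint) (auto intro: finite_subset)
      then show ?thesis using that assms(6) by simp
    qed
    then show "(\<lambda>B. M \<union> B) ` {B \<in> Pow D. sum x B \<ge> 0} \<subseteq> {B \<in> Pow C. k \<le> sum x B}"
      using C by auto
  qed (use assms(1) in auto)
  finally have "2 ^ card D \<le> 2 * card {B \<in> Pow C. k \<le> sum x B}" using * by linarith
  moreover have "card C = card M + card R + card D"
    using fin C assms(4) by (simp add: card_Un_disjoint Int_Un_distrib2)
  ultimately show ?thesis by (simp add: power_add)
qed

lemma card_zero_entries: "card {i. i < n \<and> e i \<noteq> 0} + card {i. i < n \<and> e i = (0::nat)} = n"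
proof -
  have "card {..<n} = card {i. i < n \<and> e i \<noteq> 0} + card {i. i < n \<and> e i = 0}"
    by (subst card_Un_disjoint[symmetric]) (auto intro!: arg_cong[where f=card] simp del: card_lessThan)
  then show ?thesis by simp
qed

lemma card_balance_ge:
  assumes "(\<Sum>i<n. e i) = n" and "card {i. i < n \<and> e i \<noteq> 0} + k \<le> n"
  shows "2 ^ n \<le> 2 ^ (k + min k (card {i. i < n \<and> e i > 1}) + 1) *
    card {b. b < 2 ^ n \<and> int k \<le> balance n e b}"
proof -
  let ?Z = "{i. i < n \<and> e i = 0}" and ?R = "{i. i < n \<and> e i > 1}"
  let ?x = "\<lambda>i. 1 - int (e i)"
  have kZ: "k \<le> card ?Z"
    using assms(2) card_zero_entries[of n e] by simp
  then obtain M where M: "M \<subseteq> ?Z" "card M = k"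
    using obtain_subset_with_card_n by metis
  obtain R where R: "R \<subseteq> ?R" "card R = min k (card ?R)"
    using obtain_subset_with_card_n[of "min k (card ?R)" ?R] by auto
  have sum0: "sum ?x {..<n} = 0"
    using assms(1) by (simp add: sum_subtractf flip: of_nat_sum)
  have sumR: "sum ?x R \<le> - int k"
  \<comment> \<open>With \<open>k\<close> repeated entries available, each chosen one contributes at
    most -1.\<close>
  proof (cases "k \<le> card ?R")
    case True
    have "sum ?x R \<le> (\<Sum>i\<in>R. -1)"
      by (rule sum_mono) (use R in auto)
    then show ?thesis using True R by simp
  next
    case False
    \<comment> \<open>Otherwise all repeated entries are excluded. Entries equal to 1 have weight 0
      and the total is 0, so the repeated entries weigh exactly \<open>- card ?Z\<close>, which is
      at most \<open>- k\<close>.\<close>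
    then have "R = ?R" using R by (intro card_subset_eq) auto
    have "{..<n} = ?Z \<union> (?R \<union> {i. i < n \<and> e i = 1})" by auto
    then have "sum ?x {..<n} = sum ?x (?Z \<union> (?R \<union> {i. i < n \<and> e i = 1}))" by simp
    also have "\<dots> = sum ?x ?Z + (sum ?x ?R + sum ?x {i. i < n \<and> e i = 1})"
      by (subst sum.union_disjoint, auto)+
    also have "sum ?x {i. i < n \<and> e i = 1} = 0" by simp
    also have "sum ?x ?Z = int (card ?Z)" by simp
    finally show ?thesis using sum0 kZ \<open>R = ?R\<close> by simp
  qed
  have "sum ?x M = (\<Sum>i\<in>M. 1)"
    by (rule sum.cong) (use M in auto)
  then have "sum ?x M = int k" using M by simp
  then have "2 ^ card {..<n} \<le> 2 ^ (card M + card R + 1) *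
      card {B \<in> Pow {..<n}. int k \<le> sum ?x B}"
    using M R sum0 sumR by (intro card_subsets_balanced) fastforce+
  then show ?thesis using M R by (simp add: card_balance)
qed

section \<open>Greedy covering by few sets\<close>

lemma ex_common_hit:
  assumes "finite E" "finite X" "real (card X) > 0" "\<delta> \<ge> 0"
    and "\<And>c. c \<in> E \<Longrightarrow> \<delta> * real (card X) \<le> real (card {b \<in> X. h c b})"
  shows "\<exists>b\<in>X. \<delta> * real (card E) \<le> real (card {c \<in> E. h c b})"
proof (rule ccontr)
  assume "\<not> ?thesis"
  then have less: "real (card {c \<in> E. h c b}) < \<delta> * real (card E)" if "b \<in> X" for b
    using that by (auto simp: not_le)
  \<comment> \<open>Double counting of the pairs related by \<open>h\<close>: if every
    \<open>b\<close> hit too few elements of \<open>E\<close>, the total would fall below the lower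
    bound summed over \<open>E\<close>.\<close>
  have "(\<Sum>c\<in>E. card {b \<in> X. h c b}) = (\<Sum>b\<in>X. card {c \<in> E. h c b})"
    using sum.swap_restrict[OF assms(1,2), of "\<lambda>_ _. 1::nat" h] by (simp add: assms)
  then have "(\<Sum>b\<in>X. real (card {c \<in> E. h c b})) = (\<Sum>c\<in>E. real (card {b \<in> X. h c b}))"
    by (metis (no_types, lifting) of_nat_sum sum.cong)
  moreover have "(\<Sum>c\<in>E. \<delta> * real (card X)) \<le> (\<Sum>c\<in>E. real (card {b \<in> X. h c b}))"
    by (rule sum_mono) (use assms in auto)
  moreover have "(\<Sum>b\<in>X. real (card {c \<in> E. h c b})) < (\<Sum>b\<in>X. \<delta> * real (card E))"
    by (rule sum_strict_mono) (use assms less in auto)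
  ultimately show False by (simp add: mult_ac)
qed

text \<open>Each new choice hits at least a fraction \<open>\<delta>\<close> of the elements still
  unhit, since density in \<open>X\<close> is a property of each element and survives passing to a
  subset of \<open>E\<close>.\<close>

lemma ex_hitting_sequence:
  assumes "finite E" "finite X" "X \<noteq> {}" "0 \<le> \<delta>" "\<delta> \<le> 1"
    and dense: "\<And>c. c \<in> E \<Longrightarrow> \<delta> * real (card X) \<le> real (card {b \<in> X. h c b})"
  shows "\<exists>g. (\<forall>j<N. g j \<in> X) \<and>
    real (card {c \<in> E. \<forall>j<N. \<not> h c (g j)}) \<le> (1 - \<delta>) ^ N * real (card E)"
proof (induction N)
  case (Suc N)
  then obtain g where g: "\<forall>j<N. g j \<in> X"
      "real (card {c \<in> E. \<forall>j<N. \<not> h c (g j)}) \<le> (1 - \<delta>) ^ N * real (card E)"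
    by blast
  define E' where "E' = {c \<in> E. \<forall>j<N. \<not> h c (g j)}"
  have "finite E'" using assms(1) by (simp add: E'_def)
  obtain b where b: "b \<in> X" "\<delta> * real (card E') \<le> real (card {c \<in> E'. h c b})"
    using ex_common_hit[of E' X \<delta> h] assms \<open>finite E'\<close> by (auto simp: E'_def card_gt_0_iff)
  have "card E' = card {c \<in> E'. h c b} + card {c \<in> E'. \<not> h c b}"
    using \<open>finite E'\<close> by (subst card_Un_disjoint[symmetric]) (auto intro!: arg_cong[where f=card])
  then have "real (card {c \<in> E'. \<not> h c b}) \<le> (1 - \<delta>) * real (card E')"
    using b(2) by (simp add: algebra_simps)
  also have "\<dots> \<le> (1 - \<delta>) * ((1 - \<delta>) ^ N * real (card E))"
    using g(2) assms(5) unfolding E'_def by (intro mult_left_mono) auto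
  also have "{c \<in> E'. \<not> h c b} = {c \<in> E. \<forall>j<Suc N. \<not> h c ((g(N := b)) j)}"
    by (auto simp: E'_def less_Suc_eq)
  finally have "real (card {c \<in> E. \<forall>j<Suc N. \<not> h c ((g(N := b)) j)}) \<le>
      (1 - \<delta>) ^ Suc N * real (card E)" by (simp add: mult.assoc)
  moreover have "\<forall>j<Suc N. (g(N := b)) j \<in> X" using g(1) b(1) by (auto simp: less_Suc_eq)
  ultimately show ?case by blast
qed auto

text \<open>Density at least \<open>1 / 2 ^ w\<close>, cleared of denominators so that the program
  can test it in integers.\<close>

definition dense_vector :: "nat \<Rightarrow> nat \<Rightarrow> nat \<Rightarrow> (nat \<Rightarrow> nat) \<Rightarrow> bool" where
  "dense_vector n k w e \<longleftrightarrow> 2 ^ n \<le> 2 ^ w * card {b. b < 2 ^ n \<and> int k \<le> balance n e b}"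

definition family_size :: "nat \<Rightarrow> nat \<Rightarrow> nat" where
  "family_size n w = 2 ^ w * (n * n + 1)"

definition hits :: "nat \<Rightarrow> nat \<Rightarrow> nat \<Rightarrow> nat \<Rightarrow> (nat \<Rightarrow> nat) \<Rightarrow> bool" where
  "hits n k N F e \<longleftrightarrow> (\<exists>j<N. int k \<le> balance n e (digit (2 ^ n) F j))"

text \<open>The size \<open>N = 2 ^ w * (n * n + 1)\<close> makes \<open>(1 - 1 / 2 ^ w) ^ N\<close>
  at most \<open>exp (- (n * n + 1))\<close>, while the number of vectors is at most
  \<open>(n + 1) ^ n\<close>, hence at most \<open>exp (n * n)\<close>. So fewer than one dense
  vector stays unhit after \<open>N\<close> greedy choices.\<close>

lemma ex_hitting_family:
  "\<exists>F. \<forall>c<(n + 1) ^ n. dense_vector n k w (digit (n + 1) c) \<longrightarrow>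
    hits n k (family_size n w) F (digit (n + 1) c)"
proof -
  define E where "E = {c. c < (n + 1) ^ n \<and> dense_vector n k w (digit (n + 1) c)}"
  let ?\<delta> = "1 / 2 ^ w :: real" and ?N = "family_size n w"
  let ?h = "\<lambda>c b. int k \<le> balance n (digit (n + 1) c) b"
  have "?\<delta> * real (card {..<2 ^ n :: nat}) \<le> real (card {b \<in> {..<2 ^ n}. ?h c b})" if "c \<in> E" for c
  proof -
    have "real (2 ^ n) \<le> real (2 ^ w * card {b. b < 2 ^ n \<and> ?h c b})"
      using that unfolding E_def dense_vector_def of_nat_le_iff by blast
    then show ?thesis by (simp add: field_simps)
  qed
  then obtain g where g: "\<forall>j<?N. g j < (2::nat) ^ n"
      "real (card {c \<in> E. \<forall>j<?N. \<not> ?h c (g j)}) \<le> (1 - ?\<delta>) ^ ?N * real (card E)"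
    using ex_hitting_sequence[of E "{..<2 ^ n}" ?\<delta> ?h ?N]
    by (auto simp: E_def lessThan_empty_iff)
  have "(1 - ?\<delta>) ^ ?N \<le> exp (- ?\<delta>) ^ ?N"
    using exp_ge_add_one_self[of "- ?\<delta>"] by (intro power_mono) auto
  also have "\<dots> = exp (- real (n * n + 1))"
    by (simp add: family_size_def exp_of_nat_mult[symmetric] field_simps)
  finally have 1: "(1 - ?\<delta>) ^ ?N \<le> exp (- real (n * n + 1))" .
  have "real (card E) \<le> real (card {..<(n + 1) ^ n})"
    unfolding of_nat_le_iff by (rule card_mono) (auto simp: E_def)
  also have "\<dots> = (1 + real n) ^ n" by simp
  also have "\<dots> \<le> exp (real n) ^ n"
    by (intro power_mono) (auto simp: exp_ge_add_one_self)
  also have "\<dots> = exp (real (n * n))" by (simp add: exp_of_nat_mult[symmetric])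
  finally have "(1 - ?\<delta>) ^ ?N * real (card E) \<le> exp (- real (n * n + 1)) * exp (real (n * n))"
    using 1 by (intro mult_mono) auto
  also have "\<dots> = exp (- 1)" by (simp add: exp_add[symmetric])
  also have "\<dots> < 1" by simp
  finally have "card {c \<in> E. \<forall>j<?N. \<not> ?h c (g j)} = 0" using g(2) by linarith
  then have empty: "{c \<in> E. \<forall>j<?N. \<not> ?h c (g j)} = {}" by (simp add: E_def)
  \<comment> \<open>Packing the chosen sets into one number lets a search over natural numbers run
    through all families.\<close>
  obtain F where F: "\<forall>j<?N. digit (2 ^ n) F j = g j"
    using ex_digits[of ?N g "2 ^ n"] g(1) by blast
  show ?thesis
  proof (intro exI allI impI)
    fix c assume "c < (n + 1) ^ n" "dense_vector n k w (digit (n + 1) c)"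
    then have "c \<in> E" by (simp add: E_def)
    then obtain j where "j < ?N" "?h c (g j)" using empty by blast
    then show "hits n k ?N F (digit (n + 1) c)" using F by (auto simp: hits_def)
  qed
qed

subsection \<open>Testing one set by queries\<close>

text \<open>Exponents \<open>a i\<close> in {0, 1} will encode the choice between 1 and
  \<open>z\<close>. The exponent of \<open>z\<close> is then the degree of the monomial outside the
  set.\<close>

lemma eval_mpoly_two_valued:
  assumes "in_variables n P" "\<And>i. i < n \<Longrightarrow> y i = z ^ a i"
  shows "eval_mpoly P y = (\<Sum>m\<in>Poly_Mapping.keys P.
    Poly_Mapping.lookup P m * z ^ (\<Sum>i<n. a i * Poly_Mapping.lookup m i))"
  unfolding eval_mpoly_def
proof (rule sum.cong, goal_cases)
  case (2 m)
  then have keys: "Poly_Mapping.keys m \<subseteq> {..<n}"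
    using assms(1) by (auto simp: in_variables_def)
  have "(\<Prod>i\<in>Poly_Mapping.keys m. y i ^ Poly_Mapping.lookup m i) =
      (\<Prod>i\<in>Poly_Mapping.keys m. z ^ (a i * Poly_Mapping.lookup m i))"
    using keys assms(2) by (intro prod.cong) (auto simp: power_mult)
  also have "\<dots> = z ^ (\<Sum>i\<in>Poly_Mapping.keys m. a i * Poly_Mapping.lookup m i)"
    by (rule power_sum[symmetric])
  also have "(\<Sum>i\<in>Poly_Mapping.keys m. a i * Poly_Mapping.lookup m i) =
      (\<Sum>i<n. a i * Poly_Mapping.lookup m i)"
    using keys by (intro sum.mono_neutral_left) (auto simp: in_keys_iff)
  finally show ?case by simp
qed simp

lemma monom_degree_eq_sum:
  assumes "in_variables n P" "m \<in> Poly_Mapping.keys P"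
  shows "monom_degree m = (\<Sum>i<n. Poly_Mapping.lookup m i)"
  unfolding monom_degree_def using assms
  by (intro sum.mono_neutral_left) (auto simp: in_variables_def in_keys_iff)

text \<open>The value is 1 on the set and \<open>z\<close> off it, written without a case
  distinction as the program computes it. The 0 from \<open>n\<close> on matches
  \<open>query_point\<close>.\<close>

definition test_point :: "nat \<Rightarrow> nat \<Rightarrow> int \<Rightarrow> nat \<Rightarrow> int" where
  "test_point n b z = (\<lambda>i. if i < n then z + int (digit 2 b i) * (1 - z) else 0)"

text \<open>The degree threshold: the number of indeterminates outside the set, plus
  \<open>k\<close>.\<close>

definition test_order :: "nat \<Rightarrow> nat \<Rightarrow> nat \<Rightarrow> nat" where
  "test_order n k b = (\<Sum>i<n. 1 - digit 2 b i) + k"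

text \<open>With \<open>r\<close> the order, this is \<open>(-1) ^ r\<close> times the
  \<open>r\<close>-th finite difference at 0 of the univariate restriction. The global sign is
  irrelevant to vanishing.\<close>

definition diff_test :: "nat \<Rightarrow> nat \<Rightarrow> int_mpoly \<Rightarrow> nat \<Rightarrow> int" where
  "diff_test n k P b = (\<Sum>j\<le>test_order n k b.
     (-1) ^ j * int (test_order n k b choose j) * eval_mpoly P (test_point n b (int j)))"

text \<open>By linearity the difference is a combination of values of \<open>surj_sum\<close> with
  the coefficients of \<open>P\<close>. All terms are nonnegative, so it vanishes only if every term
  does, and a term is positive exactly when its degree reaches the threshold.\<close>

lemma diff_test_nonzero_iff:
  assumes "DV_instance n P"
  shows "diff_test n k P b \<noteq> 0 \<longleftrightarrow>
    (\<exists>m\<in>Poly_Mapping.keys P. int k \<le> balance n (Poly_Mapping.lookup m) b)"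
proof -
  let ?K = "Poly_Mapping.keys P" and ?c = "Poly_Mapping.lookup P"
  let ?a = "\<lambda>i. 1 - digit 2 b i"
  define r where "r = test_order n k b"
  define d where "d m = (\<Sum>i<n. ?a i * Poly_Mapping.lookup m i)" for m
  have iv: "in_variables n P" and hom: "homogeneous n P" and nn: "\<And>m. ?c m \<ge> 0"
    using assms by (auto simp: DV_instance_def)
  have eval: "eval_mpoly P (test_point n b z) = (\<Sum>m\<in>?K. ?c m * z ^ d m)" for z
    unfolding d_def using iv
    by (rule eval_mpoly_two_valued) (auto simp: test_point_def digit_2)
  have "(-1) ^ r * diff_test n k P b =
      (\<Sum>j\<le>r. \<Sum>m\<in>?K. ?c m * ((-1) ^ (r + j) * int (r choose j) * int j ^ d m))"
    by (simp add: diff_test_def r_def[symmetric] eval sum_distrib_left power_add mult_ac)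
  also have "\<dots> = (\<Sum>m\<in>?K. ?c m * surj_sum (d m) r)"
    by (subst sum.swap) (simp add: surj_sum_def sum_distrib_left)
  finally have eq: "(-1) ^ r * diff_test n k P b = (\<Sum>m\<in>?K. ?c m * surj_sum (d m) r)" .
  have "diff_test n k P b \<noteq> 0 \<longleftrightarrow> (-1) ^ r * diff_test n k P b \<noteq> 0" by simp
  also have "\<dots> \<longleftrightarrow> (\<exists>m\<in>?K. ?c m * surj_sum (d m) r \<noteq> 0)"
    unfolding eq using nn surj_sum_nonneg_pos by (subst sum_nonneg_eq_0_iff) auto
  also have "\<dots> \<longleftrightarrow> (\<exists>m\<in>?K. int k \<le> balance n (Poly_Mapping.lookup m) b)"
  proof (rule bex_cong[OF refl])
    fix m assume m: "m \<in> ?K"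
    have "surj_sum (d m) r \<noteq> 0 \<longleftrightarrow> r \<le> d m \<and> (r = 0 \<longrightarrow> d m = 0)"
      using surj_sum_nonneg_pos[of "d m" r] by linarith
    \<comment> \<open>Order 0 means that no indeterminate lies outside the set, which forces
      \<open>d m = 0\<close>.\<close>
    also have "\<dots> \<longleftrightarrow> r \<le> d m"
      by (auto simp: r_def test_order_def d_def)
    also have "\<dots> \<longleftrightarrow> int k \<le> balance n (Poly_Mapping.lookup m) b"
    proof -
      have "(\<Sum>i<n. Poly_Mapping.lookup m i) = n"
        using monom_degree_eq_sum[OF iv m] hom m by (simp add: homogeneous_def)
      then have n: "int n = (\<Sum>i<n. int (Poly_Mapping.lookup m i))"
        by (simp flip: of_nat_sum)
      have "int (d m) - (int r - int k) = (\<Sum>i<n. int (?a i) * (int (Poly_Mapping.lookup m i) - 1))"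
        by (simp add: d_def r_def test_order_def sum_subtractf right_diff_distrib)
      \<comment> \<open>The sum over the complement becomes a sum over the set plus a term over all
        indeterminates; by homogeneity the latter is \<open>n - n = 0\<close>.\<close>
      also have "\<dots> = (\<Sum>i<n. int (digit 2 b i) * (1 - int (Poly_Mapping.lookup m i))
          + (int (Poly_Mapping.lookup m i) - 1))"
        by (rule sum.cong) (auto simp: digit_2)
      also have "\<dots> = balance n (Poly_Mapping.lookup m) b"
        using n by (simp add: balance_def sum.distrib sum_subtractf)
      finally show ?thesis by linarith
    qed
    finally show "?c m * surj_sum (d m) r \<noteq> 0 \<longleftrightarrow> int k \<le> balance n (Poly_Mapping.lookup m) b"
      using m by (simp add: in_keys_iff)
  qed
  finally show ?thesis .
qed

section \<open>Soundness and completeness of detection\<close>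

lemma balance_le:
  "balance n e b \<le> int (card {i. i < n \<and> e i = 0})"
proof -
  have "balance n e b \<le> (\<Sum>i<n. if e i = 0 then 1 else 0)"
    unfolding balance_def by (rule sum_mono) (auto simp: digit_2)
  also have "\<dots> = int (card {i. i < n \<and> e i = 0})"
    by (simp add: sum.If_cases Int_def)
  finally show ?thesis .
qed

lemma keys_conv_less:
  assumes "in_variables n P" "m \<in> Poly_Mapping.keys P"
  shows "Poly_Mapping.keys m = {i. i < n \<and> Poly_Mapping.lookup m i \<noteq> 0}"
  using assms by (auto simp: in_variables_def in_keys_iff)

text \<open>Soundness: only missing indeterminates contribute positively to the balance, each at
  most 1, so at least \<open>k\<close> of them are missing.\<close>

lemma DV_if_balanced:
  assumes "in_variables n P" "m \<in> Poly_Mapping.keys P"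
    and "int k \<le> balance n (Poly_Mapping.lookup m) b"
  shows "DV n k P"
proof -
  have "card (Poly_Mapping.keys m) + k \<le> n"
    using assms(3) balance_le[of n "Poly_Mapping.lookup m" b] card_zero_entries[of n "Poly_Mapping.lookup m"]
      keys_conv_less[OF assms(1,2)] by simp
  then show ?thesis using assms(2) by (auto simp: DV_def DV_monomials_def)
qed

text \<open>No exponent exceeds the total degree \<open>n\<close>, so each is a digit in base
  \<open>n + 1\<close>.\<close>

lemma ex_digits_monomial:
  assumes "DV_instance n P" "m \<in> Poly_Mapping.keys P"
  shows "\<exists>c<(n + 1) ^ n. \<forall>i<n. digit (n + 1) c i = Poly_Mapping.lookup m i"
proof (rule ex_digits)
  fix i assume "i < n"
  then have "Poly_Mapping.lookup m i \<le> (\<Sum>i<n. Poly_Mapping.lookup m i)"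
    by (intro member_le_sum) auto
  then show "Poly_Mapping.lookup m i < n + 1"
    using assms monom_degree_eq_sum[of n P m] by (auto simp: DV_instance_def homogeneous_def)
qed

lemma balance_cong: "(\<And>i. i < n \<Longrightarrow> e i = e' i) \<Longrightarrow> balance n e b = balance n e' b"
  by (simp add: balance_def)

lemma finite_DV_monomials: "finite (DV_monomials n k P)"
  by (simp add: DV_monomials_def)

lemma DV_s_cases:
  assumes "DV n k P"
  obtains m where "m \<in> DV_monomials n k P" "DV_s n k P = min k (repeated m)"
proof -
  have "DV_s n k P = min k (Min (repeated ` DV_monomials n k P))"
    unfolding DV_s_def using assms by (intro Min_insert) (auto simp: DV_def finite_DV_monomials)
  moreover have "Min (repeated ` DV_monomials n k P) \<in> repeated ` DV_monomials n k P"
    using assms by (intro Min_in) (auto simp: DV_def finite_DV_monomials)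
  ultimately show ?thesis using that by auto
qed

lemma DV_s_le: "DV_s n k P \<le> k"
  unfolding DV_s_def by (intro Min_le) (auto simp: finite_DV_monomials)

lemma DV_s_negative: "\<not> DV n k P \<Longrightarrow> DV_s n k P = k"
  by (simp add: DV_def DV_s_def)

text \<open>Completeness at the right stage: a monomial attaining \<open>DV_s\<close> has density at
  least \<open>1 / 2 ^ w\<close> for this \<open>w\<close>. Its code is therefore hit, and balance
  sees only the first \<open>n\<close> entries, so the hit carries over to the monomial.\<close>

lemma hitting_family_detects:
  assumes "DV_instance n P" "DV n k P" and w: "w = k + DV_s n k P + 1"
    and F: "\<forall>c<(n + 1) ^ n. dense_vector n k w (digit (n + 1) c) \<longrightarrow>
      hits n k N F (digit (n + 1) c)"
  shows "\<exists>j<N. \<exists>m\<in>Poly_Mapping.keys P.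
    int k \<le> balance n (Poly_Mapping.lookup m) (digit (2 ^ n) F j)"
proof -
  obtain m where m: "m \<in> DV_monomials n k P" "DV_s n k P = min k (repeated m)"
    using DV_s_cases[OF assms(2)] .
  let ?e = "Poly_Mapping.lookup m"
  have mP: "m \<in> Poly_Mapping.keys P" and iv: "in_variables n P"
    using m assms(1) by (auto simp: DV_monomials_def DV_instance_def)
  have keys: "Poly_Mapping.keys m = {i. i < n \<and> ?e i \<noteq> 0}"
    using keys_conv_less[OF iv mP] .
  then have "{i. ?e i > 1} = {i. i < n \<and> ?e i > 1}"
    unfolding set_eq_iff in_keys_iff mem_Collect_eq by (metis not_less_zero)
  then have rep: "repeated m = card {i. i < n \<and> ?e i > 1}"
    by (simp add: repeated_def)
  have "(\<Sum>i<n. ?e i) = n"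
    using monom_degree_eq_sum[OF iv mP] assms(1) mP by (simp add: DV_instance_def homogeneous_def)
  moreover have "card {i. i < n \<and> ?e i \<noteq> 0} + k \<le> n"
    using m(1) keys by (simp add: DV_monomials_def)
  ultimately have "dense_vector n k w ?e"
    using card_balance_ge[of ?e n k] m(2) rep w by (simp add: dense_vector_def)
  moreover obtain c where c: "c < (n + 1) ^ n" "\<And>i. i < n \<Longrightarrow> digit (n + 1) c i = ?e i"
    using ex_digits_monomial[OF assms(1) mP] by blast
  moreover have bal: "balance n (digit (n + 1) c) b = balance n ?e b" for b
    by (rule balance_cong) (rule c)
  ultimately have "hits n k N F (digit (n + 1) c)"
    using F by (simp add: dense_vector_def)
  then show ?thesis using mP unfolding hits_def bal by blast
qed

subsection \<open>Total correctness of query programs\<close>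

text \<open>Programs without coin tosses have point-mass semantics, so termination and correctness are
  captured by one deterministic final configuration.\<close>

definition wp :: "nat \<Rightarrow> int_mpoly \<Rightarrow> com \<Rightarrow> (config \<Rightarrow> bool) \<Rightarrow> config \<Rightarrow> bool" where
  "wp n P c Q cfg \<longleftrightarrow> (\<exists>cfg'. exec n P c cfg = return_spmf cfg' \<and> Q cfg')"

lemma wp_Skip: "Q cfg \<Longrightarrow> wp n P Skip Q cfg"
  by (simp add: wp_def)

lemma wp_Assign:
  "Q (store_upd \<sigma> x (aval e \<sigma>) (aval f \<sigma>), qs) \<Longrightarrow> wp n P (Assign x e f) Q (\<sigma>, qs)"
  by (simp add: wp_def)

lemma wp_Query:
  "Q (store_upd \<sigma> x 0 (eval_mpoly P (query_point n \<sigma> a)), query_point n \<sigma> a # qs) \<Longrightarrow>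
    wp n P (Query x a) Q (\<sigma>, qs)"
  by (simp add: wp_def Let_def)

lemma wp_Seq: "wp n P c (wp n P d Q) cfg \<Longrightarrow> wp n P (Seq c d) Q cfg"
  by (auto simp: wp_def)

lemma wp_If:
  "(bval b (fst cfg) \<Longrightarrow> wp n P c Q cfg) \<Longrightarrow> (\<not> bval b (fst cfg) \<Longrightarrow> wp n P d Q cfg) \<Longrightarrow>
    wp n P (If b c d) Q cfg"
  by (simp add: wp_def)

text \<open>Well-founded induction unrolls the loop. As each round ends in a point mass, the bind
  collapses and the loop continues from a single smaller configuration.\<close>

lemma wp_While:
  assumes "wf R" "I cfg"
    and step: "\<And>cfg. I cfg \<Longrightarrow> bval b (fst cfg) \<Longrightarrow> wp n P c (\<lambda>cfg'. I cfg' \<and> (cfg', cfg) \<in> R) cfg"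
    and exit: "\<And>cfg. I cfg \<Longrightarrow> \<not> bval b (fst cfg) \<Longrightarrow> Q cfg"
  shows "wp n P (While b c) Q cfg"
  using assms(1,2)
proof (induction cfg rule: wf_induct_rule)
  case (less cfg)
  show ?case
  proof (cases "bval b (fst cfg)")
    case True
    then obtain cfg' where cfg': "exec n P c cfg = return_spmf cfg'" "I cfg'" "(cfg', cfg) \<in> R"
      using step[OF less.prems True] unfolding wp_def by blast
    then have "wp n P (While b c) Q cfg'" using less.IH by blast
    then show ?thesis using True cfg'(1)
      by (simp add: wp_def while_spmf.simps[of _ _ cfg])
  next
    case False
    then show ?thesis using exit less.prems
      by (simp add: wp_def while_spmf.simps[of _ _ cfg])
  qed
qed

text \<open>The rule for counting loops: induction on the number of rounds left, with the round
  index passed to the invariant, so that no measure on stores is needed.\<close>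

lemma wp_for:
  assumes "I 0 \<sigma> qs"
    and step: "\<And>j \<sigma> qs. j < m \<Longrightarrow> I j \<sigma> qs \<Longrightarrow> wp n P c (\<lambda>(\<sigma>', qs'). I (Suc j) \<sigma>' qs') (\<sigma>, qs)"
    and cond: "\<And>j \<sigma> qs. j \<le> m \<Longrightarrow> I j \<sigma> qs \<Longrightarrow> bval b \<sigma> \<longleftrightarrow> j < m"
    and exit: "\<And>\<sigma> qs. I m \<sigma> qs \<Longrightarrow> Q (\<sigma>, qs)"
  shows "wp n P (While b c) Q (\<sigma>, qs)"
proof -
  have "wp n P (While b c) Q (\<sigma>, qs)" if "I (m - j) \<sigma> qs" "j \<le> m" for j \<sigma> qs
    using that
  proof (induction j arbitrary: \<sigma> qs)
    case 0
    then show ?case using cond[of m \<sigma> qs] exit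
      by (simp add: wp_def while_spmf.simps)
  next
    case (Suc j)
    then have "wp n P c (\<lambda>(\<sigma>', qs'). I (Suc (m - Suc j)) \<sigma>' qs') (\<sigma>, qs)"
      by (intro step) auto
    then obtain \<sigma>' qs' where *: "exec n P c (\<sigma>, qs) = return_spmf (\<sigma>', qs')" "I (m - j) \<sigma>' qs'"
      using Suc.prems by (auto simp: wp_def Suc_diff_Suc)
    then have "wp n P (While b c) Q (\<sigma>', qs')" using Suc by simp
    moreover have "bval b \<sigma>" using cond[of "m - Suc j" \<sigma> qs] Suc.prems by simp
    ultimately show ?case using *(1)
      by (simp add: wp_def while_spmf.simps[of _ _ "(\<sigma>, qs)"])
  qed
  from this[of m \<sigma> qs] show ?thesis using assms(1) by simp
qed

section \<open>Frame conditions: which variables a program may change\<close>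

definition agree_off :: "vname set \<Rightarrow> store \<Rightarrow> store \<Rightarrow> bool" where
  "agree_off W \<sigma> \<sigma>' \<longleftrightarrow> (\<forall>x. x \<notin> W \<longrightarrow> \<sigma>' x = \<sigma> x)"

lemmas store_simps = agree_off_def store_upd_def

lemma store_upd_apply: "store_upd \<sigma> x i v y j = (if y = x \<and> j = i then v else \<sigma> y j)"
  by (simp add: store_upd_def)

lemma agree_off_refl: "agree_off W \<sigma> \<sigma>"
  by (simp add: agree_off_def)

lemma agree_off_upd: "x \<in> W \<Longrightarrow> agree_off W \<sigma> (store_upd \<sigma>' x i v) \<longleftrightarrow> agree_off W \<sigma> \<sigma>'"
  by (auto simp: agree_off_def store_upd_def)

lemma agree_off_trans:
  "agree_off W' \<sigma>' \<sigma>'' \<Longrightarrow> W' \<subseteq> W \<Longrightarrow> agree_off W \<sigma> \<sigma>' \<Longrightarrow> agree_off W \<sigma> \<sigma>''"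
  by (auto simp: agree_off_def)

lemma agree_offD: "agree_off W \<sigma> \<sigma>' \<Longrightarrow> x \<notin> W \<Longrightarrow> \<sigma>' x = \<sigma> x"
  by (simp add: agree_off_def)

abbreviation V :: "vname \<Rightarrow> aexp" where
  "V x \<equiv> Cell x (Num 0)"

abbreviation set_var :: "vname \<Rightarrow> aexp \<Rightarrow> com" (infix "::=" 61) where
  "x ::= e \<equiv> Assign x (Num 0) e"

abbreviation seq_com :: "com \<Rightarrow> com \<Rightarrow> com" (infixr ";;" 60) where
  "c ;; d \<equiv> Seq c d"

abbreviation incr :: "vname \<Rightarrow> com" where
  "incr x \<equiv> x ::= Plus (V x) (Num 1)"

definition power_com :: "vname \<Rightarrow> aexp \<Rightarrow> aexp \<Rightarrow> com" where
  "power_com x b m =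
    x ::= Num 1;; ''i'' ::= Num 0;;
    While (Less (V ''i'') m) (x ::= Times (V x) b;; incr ''i'')"

lemma wp_power_com:
  assumes "x \<noteq> ''i''"
    and "\<And>\<sigma>'. agree_off {x, ''i''} \<sigma> \<sigma>' \<Longrightarrow> aval b \<sigma>' = int b' \<and> aval m \<sigma>' = int m'"
    and "\<And>\<sigma>'. agree_off {x, ''i''} \<sigma> \<sigma>' \<Longrightarrow> \<sigma>' x 0 = int (b' ^ m') \<Longrightarrow> Q (\<sigma>', qs)"
  shows "wp n P (power_com x b m) Q (\<sigma>, qs)"
  unfolding power_com_def
proof (intro wp_Seq wp_Assign, rule wp_for[where m = m' and
    I = "\<lambda>j \<sigma>' qs'. agree_off {x, ''i''} \<sigma> \<sigma>' \<and> \<sigma>' ''i'' 0 = int j \<and> \<sigma>' x 0 = int (b' ^ j) \<and> qs' = qs"],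
    goal_cases)
  case (2 j \<sigma>' qs')
  then show ?case
    using assms(1,2) by (intro wp_Seq wp_Assign) (auto simp: store_simps)
qed (use assms in \<open>auto simp: store_simps\<close>)

subsection \<open>The program\<close>

text \<open>\<open>c\<close> codes the current exponent vector, \<open>b\<close> the current set and \<open>F\<close> the current family;
  \<open>T = 2 ^ n\<close>, \<open>D = (n + 1) ^ n\<close>, \<open>N\<close> is the family size and \<open>U = 2 ^ w\<close>, where \<open>1 / 2 ^ w\<close>
  is the density threshold.\<close>

definition balance_com :: com where
  "balance_com =
    ''x'' ::= Num 0;; ''i'' ::= Num 0;; ''e'' ::= V ''c'';; ''f'' ::= V ''b'';;
    While (Less (V ''i'') (V ''n''))
     (''x'' ::= Plus (V ''x'') (Times (Mod (V ''f'') (Num 2))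
        (Minus (Num 1) (Mod (V ''e'') (Plus (V ''n'') (Num 1)))));;
      ''e'' ::= Div (V ''e'') (Plus (V ''n'') (Num 1));;
      ''f'' ::= Div (V ''f'') (Num 2);;
      incr ''i'')"

lemma int_digit: "int (digit d c i) = int (c div d ^ i) mod int d"
  by (simp add: digit_def of_nat_mod)

lemma int_div_power_Suc: "int (c div d ^ Suc i) = int (c div d ^ i) div int d"
  by (simp only: power_Suc2 div_mult2_eq of_nat_div)

lemma wp_balance_com:
  assumes "\<sigma> ''n'' 0 = int n" "\<sigma> ''c'' 0 = int c" "\<sigma> ''b'' 0 = int b"
    and "\<And>\<sigma>'. agree_off {''x'', ''i'', ''e'', ''f''} \<sigma> \<sigma>' \<Longrightarrow>
      \<sigma>' ''x'' 0 = balance n (digit (n + 1) c) b \<Longrightarrow> Q (\<sigma>', qs)"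
  shows "wp n P balance_com Q (\<sigma>, qs)"
  unfolding balance_com_def
\<comment> \<open>After \<open>j\<close> rounds \<open>e\<close> and \<open>f\<close> hold the codes
  with \<open>j\<close> digits stripped off, so the next digit is a remainder.\<close>
proof (intro wp_Seq wp_Assign, rule wp_for[where m = n and
    I = "\<lambda>j \<sigma>' qs'. agree_off {''x'', ''i'', ''e'', ''f''} \<sigma> \<sigma>' \<and> \<sigma>' ''i'' 0 = int j \<and>
      \<sigma>' ''e'' 0 = int (c div (n + 1) ^ j) \<and> \<sigma>' ''f'' 0 = int (b div 2 ^ j) \<and>
      \<sigma>' ''x'' 0 = balance j (digit (n + 1) c) b \<and> qs' = qs"], goal_cases)
  case (2 j \<sigma>' qs')
  have "balance (Suc j) (digit (n + 1) c) b = balance j (digit (n + 1) c) b +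
      int (b div 2 ^ j) mod 2 * (1 - int (c div (n + 1) ^ j) mod (int n + 1))"
    by (simp add: balance_def int_digit add.commute)
  moreover have "int (c div (n + 1) ^ Suc j) = int (c div (n + 1) ^ j) div (int n + 1)"
    "int (b div 2 ^ Suc j) = int (b div 2 ^ j) div 2"
    by (simp_all only: int_div_power_Suc) (simp_all add: add.commute)
  moreover have "\<sigma>' ''n'' 0 = int n" using 2 assms(1) by (simp add: store_simps)
  ultimately show ?case
    using 2 by (intro wp_Seq wp_Assign) (auto simp: store_simps simp del: power_Suc)
qed (use assms in \<open>auto simp: store_simps balance_def\<close>)

definition density_com :: com where
  "density_com =
    ''m'' ::= Num 0;; ''b'' ::= Num 0;;
    While (Less (V ''b'') (V ''T''))
     (balance_com;; If (Less (V ''x'') (V ''k'')) Skip (incr ''m'');; incr ''b'')"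

lemma wp_density_com:
  assumes "\<sigma> ''n'' 0 = int n" "\<sigma> ''k'' 0 = int k" "\<sigma> ''c'' 0 = int c" "\<sigma> ''T'' 0 = 2 ^ n"
    and "\<And>\<sigma>'. agree_off {''x'', ''i'', ''e'', ''f'', ''m'', ''b''} \<sigma> \<sigma>' \<Longrightarrow>
      \<sigma>' ''m'' 0 = int (card {b. b < 2 ^ n \<and> int k \<le> balance n (digit (n + 1) c) b}) \<Longrightarrow> Q (\<sigma>', qs)"
  shows "wp n P density_com Q (\<sigma>, qs)"
  unfolding density_com_def
proof (intro wp_Seq wp_Assign, rule wp_for[where m = "2 ^ n" and
    I = "\<lambda>j \<sigma>' qs'. agree_off {''x'', ''i'', ''e'', ''f'', ''m'', ''b''} \<sigma> \<sigma>' \<and> \<sigma>' ''b'' 0 = int j \<and>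
      \<sigma>' ''m'' 0 = int (card {b. b < j \<and> int k \<le> balance n (digit (n + 1) c) b}) \<and> qs' = qs"], goal_cases)
  case (2 j \<sigma>' qs')
  have "{b. b < Suc j \<and> int k \<le> balance n (digit (n + 1) c) b} =
      (if int k \<le> balance n (digit (n + 1) c) j then insert j else id)
        {b. b < j \<and> int k \<le> balance n (digit (n + 1) c) b}"
    by (auto simp: less_Suc_eq)
  then have card: "card {b. b < Suc j \<and> int k \<le> balance n (digit (n + 1) c) b} =
      card {b. b < j \<and> int k \<le> balance n (digit (n + 1) c) b} +
      of_bool (int k \<le> balance n (digit (n + 1) c) j)"
    by simp
  have I: "agree_off {''x'', ''i'', ''e'', ''f'', ''m'', ''b''} \<sigma> \<sigma>'" "\<sigma>' ''b'' 0 = int j"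
    "\<sigma>' ''m'' 0 = int (card {b. b < j \<and> int k \<le> balance n (digit (n + 1) c) b})" "qs' = qs"
    using 2 by auto
  note eq1 = agree_offD[OF I(1)]
  show ?case
  proof (intro wp_Seq, rule wp_balance_com[where c = c and b = j], goal_cases)
    case (4 \<sigma>'')
    note eq2 = agree_offD[OF 4(1)]
    have "agree_off {''x'', ''i'', ''e'', ''f'', ''m'', ''b''} \<sigma> \<sigma>''"
      by (rule agree_off_trans[OF 4(1) _ I(1)]) simp
    then show ?case
      by (intro wp_Seq wp_If wp_Skip wp_Assign)
        (use card in \<open>simp_all add: eq1 eq2 I 4(2) assms agree_off_upd store_upd_apply\<close>)
  qed (use I assms in \<open>simp_all add: eq1\<close>)
qed (use assms in \<open>auto simp: store_simps\<close>)

definition hit_com :: com where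
  "hit_com =
    ''g'' ::= Num 0;; ''h'' ::= V ''F'';; ''j'' ::= Num 0;;
    While (Less (V ''j'') (V ''N''))
     (''b'' ::= Mod (V ''h'') (V ''T'');; ''h'' ::= Div (V ''h'') (V ''T'');;
      balance_com;; If (Less (V ''x'') (V ''k'')) Skip (''g'' ::= Num 1);; incr ''j'')"

lemma wp_hit_com:
  assumes "\<sigma> ''n'' 0 = int n" "\<sigma> ''k'' 0 = int k" "\<sigma> ''c'' 0 = int c" "\<sigma> ''T'' 0 = 2 ^ n"
    "\<sigma> ''N'' 0 = int N" "\<sigma> ''F'' 0 = int F"
    and "\<And>\<sigma>'. agree_off {''x'', ''i'', ''e'', ''f'', ''g'', ''h'', ''j'', ''b''} \<sigma> \<sigma>' \<Longrightarrow>
      \<sigma>' ''g'' 0 = of_bool (hits n k N F (digit (n + 1) c)) \<Longrightarrow> Q (\<sigma>', qs)"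
  shows "wp n P hit_com Q (\<sigma>, qs)"
proof -
  \<comment> \<open>\<open>u j\<close> is the family code without its first \<open>j\<close> sets,
    \<open>d j\<close> the code of the next set.\<close>
  define u where "u j = int (F div (2 ^ n) ^ j)" for j
  define d where "d j = int (digit (2 ^ n) F j)" for j
  have u_0: "u 0 = int F" and mod: "u j mod 2 ^ n = d j" and div: "u j div 2 ^ n = u (Suc j)" for j
    unfolding u_def d_def int_digit int_div_power_Suc by simp_all
  have hits: "hits n k (Suc j) F (digit (n + 1) c) \<longleftrightarrow> hits n k j F (digit (n + 1) c) \<or>
      int k \<le> balance n (digit (n + 1) c) (digit (2 ^ n) F j)" for j
    by (auto simp: hits_def less_Suc_eq)
  show ?thesis
    unfolding hit_com_def
  proof (intro wp_Seq wp_Assign, rule wp_for[where m = N and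
      I = "\<lambda>j \<sigma>' qs'. agree_off {''x'', ''i'', ''e'', ''f'', ''g'', ''h'', ''j'', ''b''} \<sigma> \<sigma>' \<and>
        \<sigma>' ''j'' 0 = int j \<and> \<sigma>' ''h'' 0 = u j \<and>
        \<sigma>' ''g'' 0 = of_bool (hits n k j F (digit (n + 1) c)) \<and> qs' = qs"], goal_cases)
    case (2 j \<sigma>' qs')
    have I: "agree_off {''x'', ''i'', ''e'', ''f'', ''g'', ''h'', ''j'', ''b''} \<sigma> \<sigma>'"
      "\<sigma>' ''j'' 0 = int j" "\<sigma>' ''h'' 0 = u j" "qs' = qs"
      "\<sigma>' ''g'' 0 = of_bool (hits n k j F (digit (n + 1) c))"
      using 2 by auto
    note eq1 = agree_offD[OF I(1)]
    show ?case
    proof (intro wp_Seq wp_Assign,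
        rule wp_balance_com[where c = c and b = "digit (2 ^ n) F j"], goal_cases)
      case (4 \<sigma>'')
      note eq2 = agree_offD[OF 4(1)]
      have "agree_off {''x'', ''i'', ''e'', ''f'', ''g'', ''h'', ''j'', ''b''} \<sigma> \<sigma>''"
        by (rule agree_off_trans[OF 4(1)]) (simp_all add: agree_off_upd I)
      then show ?case
        by (intro wp_Seq wp_If wp_Skip wp_Assign)
          (use hits[of j] in \<open>simp_all add: eq1 eq2 I 4(2) assms(1-6) agree_off_upd store_upd_apply div\<close>)
    qed (use I assms(1-6) in \<open>simp_all add: eq1 store_upd_apply mod flip: d_def\<close>)
  qed (use assms in \<open>auto simp: store_simps hits_def u_0\<close>)
qed

text \<open>The scan of exponent vectors restarts with the next \<open>F\<close> at the first dense vector that is not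
  hit. It cannot run past a good family, and one exists by \<open>ex_hitting_family\<close>.\<close>

definition search_com :: com where
  "search_com =
    ''F'' ::= Num 0;; ''c'' ::= Num 0;;
    While (Less (V ''c'') (V ''D''))
     (density_com;; hit_com;;
      If (And (Not (Less (Times (V ''U'') (V ''m'')) (V ''T''))) (Less (V ''g'') (Num 1)))
        (incr ''F'';; ''c'' ::= Num 0) (incr ''c''))"

definition search_vars :: "vname set" where
  "search_vars = {''x'', ''i'', ''e'', ''f'', ''m'', ''b'', ''g'', ''h'', ''j'', ''F'', ''c''}"

definition hitting_family :: "nat \<Rightarrow> nat \<Rightarrow> nat \<Rightarrow> nat \<Rightarrow> bool" where
  "hitting_family n k w F \<longleftrightarrow> (\<forall>c<(n + 1) ^ n. dense_vector n k w (digit (n + 1) c) \<longrightarrow>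
    hits n k (family_size n w) F (digit (n + 1) c))"

lemma wp_search_com:
  assumes "\<sigma> ''n'' 0 = int n" "\<sigma> ''k'' 0 = int k" "\<sigma> ''T'' 0 = 2 ^ n" "\<sigma> ''D'' 0 = int ((n + 1) ^ n)"
    "\<sigma> ''U'' 0 = 2 ^ w" "\<sigma> ''N'' 0 = int (family_size n w)"
    and Q: "\<And>\<sigma>' F. agree_off search_vars \<sigma> \<sigma>' \<Longrightarrow> \<sigma>' ''F'' 0 = int F \<Longrightarrow> hitting_family n k w F \<Longrightarrow>
      Q (\<sigma>', qs)"
  shows "wp n P search_com Q (\<sigma>, qs)"
proof -
  let ?D = "(n + 1) ^ n"
  let ?ok = "\<lambda>F c. dense_vector n k w (digit (n + 1) c) \<longrightarrow> hits n k (family_size n w) F (digit (n + 1) c)"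
  obtain G where G: "hitting_family n k w G"
    using ex_hitting_family unfolding hitting_family_def by blast
  define J where "J \<sigma>' qs' F c \<longleftrightarrow> agree_off search_vars \<sigma> \<sigma>' \<and> qs' = qs \<and> \<sigma>' ''F'' 0 = int F \<and> \<sigma>' ''c'' 0 = int c \<and>
    F \<le> G \<and> c \<le> ?D \<and> (\<forall>c'<c. ?ok F c')" for \<sigma>' qs' F c
  let ?I = "\<lambda>(\<sigma>', qs'). \<exists>F c. J \<sigma>' qs' F c"
  \<comment> \<open>Trying the next family resets \<open>c\<close>, hence the lexicographic order.
    Its first component is meaningful because \<open>F\<close> stays at most
    \<open>G\<close>.\<close>
  let ?R = "inv_image (less_than <*lex*> less_than)
    (\<lambda>(\<sigma>', qs' :: (nat \<Rightarrow> int) list). (nat (int G - \<sigma>' ''F'' 0), nat (int ?D - \<sigma>' ''c'' 0)))"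
  show ?thesis
    unfolding search_com_def
  proof (intro wp_Seq wp_Assign, rule wp_While[where R = ?R and I = ?I], goal_cases)
    case 1
    show ?case by (intro wf_inv_image wf_lex_prod wf_less_than)
  next
    case 2
    have "J (store_upd (store_upd \<sigma> ''F'' 0 0) ''c'' 0 0) qs 0 0"
      by (simp add: J_def store_simps search_vars_def)
    then show ?case by auto
  next
    case (3 cfg)
    obtain \<sigma>' qs' where cfg: "cfg = (\<sigma>', qs')" by (cases cfg)
    have "\<exists>F c. J \<sigma>' qs' F c"
      using 3(1) unfolding cfg prod.case .
    then obtain F c where J: "agree_off search_vars \<sigma> \<sigma>'" "qs' = qs" "\<sigma>' ''F'' 0 = int F"
      "\<sigma>' ''c'' 0 = int c" "F \<le> G" "c \<le> ?D" "\<And>c'. c' < c \<Longrightarrow> ?ok F c'"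
      unfolding J_def by blast
    note eq = agree_offD[OF J(1)]
    have "\<sigma>' ''D'' 0 = int ?D" using assms(4) by (simp add: eq search_vars_def)
    then have "c < ?D"
      using J(4) 3(2) unfolding cfg by (simp only: bval.simps aval.simps fst_conv of_nat_less_iff)
    have vars: "\<sigma>' ''n'' 0 = int n" "\<sigma>' ''k'' 0 = int k" "\<sigma>' ''T'' 0 = 2 ^ n" "\<sigma>' ''U'' 0 = 2 ^ w"
      "\<sigma>' ''N'' 0 = int (family_size n w)"
      using assms by (simp_all add: eq search_vars_def)
    \<comment> \<open>\<open>G\<close> has no failing vector, so a family that fails differs from
      \<open>G\<close>.\<close>
    have FG: "F < G" if "\<not> ?ok F c"
      using that J(5) G \<open>c < ?D\<close> unfolding hitting_family_def le_less by blast
    show ?case unfolding cfg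
    proof (intro wp_Seq, rule wp_density_com[where k = k and c = c], goal_cases)
      case (5 \<sigma>1)
      have vars1: "\<sigma>1 ''n'' 0 = int n" "\<sigma>1 ''k'' 0 = int k" "\<sigma>1 ''T'' 0 = 2 ^ n" "\<sigma>1 ''U'' 0 = 2 ^ w"
        "\<sigma>1 ''N'' 0 = int (family_size n w)" "\<sigma>1 ''F'' 0 = int F" "\<sigma>1 ''c'' 0 = int c"
        by (simp_all add: agree_offD[OF 5(1)] vars J)
      have agree1: "agree_off search_vars \<sigma> \<sigma>1"
        by (rule agree_off_trans[OF 5(1) _ J(1)]) (simp add: search_vars_def)
      have dense: "dense_vector n k w (digit (n + 1) c) \<longleftrightarrow> \<not> \<sigma>1 ''U'' 0 * \<sigma>1 ''m'' 0 < \<sigma>1 ''T'' 0"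
      proof -
        have "dense_vector n k w (digit (n + 1) c) \<longleftrightarrow> int (2 ^ n) \<le>
            int (2 ^ w * card {b. b < 2 ^ n \<and> int k \<le> balance n (digit (n + 1) c) b})"
          unfolding dense_vector_def of_nat_le_iff ..
        then show ?thesis unfolding 5 vars1 by (simp add: not_less)
      qed
      show ?case
      proof (intro wp_Seq, rule wp_hit_com[where k = k and c = c and N = "family_size n w" and F = F], goal_cases)
        case (7 \<sigma>2)
        have vars2: "\<sigma>2 ''U'' 0 = \<sigma>1 ''U'' 0" "\<sigma>2 ''m'' 0 = \<sigma>1 ''m'' 0" "\<sigma>2 ''T'' 0 = \<sigma>1 ''T'' 0"
          "\<sigma>2 ''F'' 0 = int F" "\<sigma>2 ''c'' 0 = int c"
          by (simp_all add: agree_offD[OF 7(1)] vars1)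
        have agree2: "agree_off search_vars \<sigma> \<sigma>2"
          by (rule agree_off_trans[OF 7(1) _ agree1]) (simp add: search_vars_def)
        show ?case
        proof (rule wp_If, goal_cases)
          case 1
          then have "\<not> ?ok F c" unfolding dense using 7(2) by (auto simp: vars2)
          then have "F < G" by (rule FG)
          let ?\<sigma>3 = "store_upd (store_upd \<sigma>2 ''F'' 0 (int F + 1)) ''c'' 0 0"
          have "J ?\<sigma>3 qs' (F + 1) 0"
            using \<open>F < G\<close> agree2 J(2)
            by (simp add: J_def agree_off_upd store_upd_apply search_vars_def)
          then have "?I (?\<sigma>3, qs')" by blast
          moreover have "((?\<sigma>3, qs'), (\<sigma>', qs')) \<in> ?R"
            using \<open>F < G\<close> J(3) by (simp add: store_upd_apply)
          ultimately show ?case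
            by (intro wp_Seq wp_Assign) (simp add: store_upd_apply vars2)
        next
          case 2
          then have ok: "?ok F c" unfolding dense using 7(2) by (auto simp: vars2)
          let ?\<sigma>3 = "store_upd \<sigma>2 ''c'' 0 (int c + 1)"
          have "J ?\<sigma>3 qs' F (c + 1)"
            unfolding J_def
          proof (intro conjI allI impI)
            fix c' assume "c' < c + 1" "dense_vector n k w (digit (n + 1) c')"
            then show "hits n k (family_size n w) F (digit (n + 1) c')"
              using J(7) ok by (cases "c' = c") auto
          next
            show "c + 1 \<le> ?D"
              using \<open>c < ?D\<close> by linarith
          qed (use agree2 J(2,5) vars2 in
              \<open>simp_all add: agree_off_upd store_upd_apply search_vars_def\<close>)
          then have "?I (?\<sigma>3, qs')" by blast
          moreover have "((?\<sigma>3, qs'), (\<sigma>', qs')) \<in> ?R"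
            using of_nat_less_iff[where 'a = int, THEN iffD2, OF \<open>c < ?D\<close>] J(3,4)
            by (simp add: store_upd_apply vars2)
          ultimately show ?case
            by (intro wp_Assign) (simp add: vars2)
        qed
      qed (simp_all add: vars1)
    qed (simp_all add: vars J)
  next
    case (4 cfg)
    obtain \<sigma>' qs' where cfg: "cfg = (\<sigma>', qs')" by (cases cfg)
    have "\<exists>F c. J \<sigma>' qs' F c"
      using 4(1) unfolding cfg prod.case .
    then obtain F c where J: "agree_off search_vars \<sigma> \<sigma>'" "qs' = qs" "\<sigma>' ''F'' 0 = int F"
      "\<sigma>' ''c'' 0 = int c" "F \<le> G" "c \<le> ?D" "\<And>c'. c' < c \<Longrightarrow> ?ok F c'"
      unfolding J_def by blast
    have "\<sigma>' ''D'' 0 = int ?D"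
      using assms(4) by (simp add: agree_offD[OF J(1)] search_vars_def)
    then have "\<not> c < ?D"
      using J(4) 4(2) unfolding cfg by (simp only: bval.simps aval.simps fst_conv of_nat_less_iff not_False_eq_True)
    then have "c = ?D" using J(6) by linarith
    then have "hitting_family n k w F" using J(7) unfolding hitting_family_def by blast
    then show ?case using Q J(1-3) cfg by blast
  qed
qed

section \<open>Querying the test points of a family\<close>

definition point_com :: com where
  "point_com =
    ''i'' ::= Num 0;; ''f'' ::= V ''b'';;
    While (Less (V ''i'') (V ''n''))
     (Assign ''a'' (V ''i'') (Plus (V ''z'') (Times (Mod (V ''f'') (Num 2)) (Minus (Num 1) (V ''z''))));;
      ''f'' ::= Div (V ''f'') (Num 2);; incr ''i'')"

lemma wp_point_com:
  assumes "\<sigma> ''n'' 0 = int n" "\<sigma> ''b'' 0 = int b" "\<sigma> ''z'' 0 = z"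
    and "\<And>\<sigma>'. agree_off {''i'', ''f'', ''a''} \<sigma> \<sigma>' \<Longrightarrow>
      query_point n \<sigma>' ''a'' = test_point n b z \<Longrightarrow> Q (\<sigma>', qs)"
  shows "wp n P point_com Q (\<sigma>, qs)"
  unfolding point_com_def
proof (intro wp_Seq wp_Assign, rule wp_for[where m = n and
    I = "\<lambda>j \<sigma>' qs'. agree_off {''i'', ''f'', ''a''} \<sigma> \<sigma>' \<and> \<sigma>' ''i'' 0 = int j \<and>
      \<sigma>' ''f'' 0 = int (b div 2 ^ j) \<and> (\<forall>i<j. \<sigma>' ''a'' (int i) = test_point n b z i) \<and> qs' = qs"],
    goal_cases)
  case (2 j \<sigma>' qs')
  have I: "agree_off {''i'', ''f'', ''a''} \<sigma> \<sigma>'" "\<sigma>' ''i'' 0 = int j"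
    "\<sigma>' ''f'' 0 = int (b div 2 ^ j)" "\<And>i. i < j \<Longrightarrow> \<sigma>' ''a'' (int i) = test_point n b z i" "qs' = qs"
    using 2 by auto
  note eq = agree_offD[OF I(1)]
  have "test_point n b z j = z + int (b div 2 ^ j) mod 2 * (1 - z)"
    using 2(1) by (simp add: test_point_def int_digit)
  moreover have "int (b div 2 ^ Suc j) = int (b div 2 ^ j) div 2"
    by (simp only: int_div_power_Suc) simp
  ultimately show ?case
    by (intro wp_Seq wp_Assign)
      (simp add: eq I assms(1-3) agree_off_upd store_upd_apply less_Suc_eq del: power_Suc)
next
  case (4 \<sigma>' qs')
  then have "query_point n \<sigma>' ''a'' = test_point n b z"
    by (auto simp: query_point_def test_point_def)
  then show ?case using 4 assms(4) by auto
qed (use assms in \<open>auto simp: store_simps\<close>)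

text \<open>With \<open>c = 0\<close>, \<^const>\<open>balance_com\<close> computes the size of the set. The coefficient \<open>u\<close> is
  \<open>(-1) ^ z * (r choose z)\<close>, updated by an exact division.\<close>

definition test_com :: com where
  "test_com =
    ''c'' ::= Num 0;; balance_com;;
    ''r'' ::= Plus (Minus (V ''n'') (V ''x'')) (V ''k'');;
    ''s'' ::= Num 0;; ''u'' ::= Num 1;; ''z'' ::= Num 0;;
    While (Less (V ''z'') (Plus (V ''r'') (Num 1)))
     (point_com;; Query ''v'' ''a'';;
      ''s'' ::= Plus (V ''s'') (Times (V ''u'') (V ''v''));;
      ''u'' ::= Div (Times (V ''u'') (Minus (V ''z'') (V ''r''))) (Plus (V ''z'') (Num 1));;
      incr ''z'');;
    If (Less (Num 0) (Times (V ''s'') (V ''s''))) (''accept'' ::= Num 1) Skip"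

definition test_vars :: "vname set" where
  "test_vars = {''c'', ''x'', ''i'', ''e'', ''f'', ''r'', ''s'', ''u'', ''z'', ''a'', ''v'', ''accept''}"

lemma test_order_eq_balance: "int (test_order n k b) = int n - balance n (digit (n + 1) 0) b + int k"
proof -
  have "int (test_order n k b) = (\<Sum>i<n. 1 - int (digit 2 b i)) + int k"
    unfolding test_order_def by (simp add: digit_2 of_nat_diff)
  moreover have "digit (n + 1) 0 i = 0" for i
    by (simp add: digit_def)
  ultimately show ?thesis
    by (simp add: balance_def sum_subtractf)
qed

text \<open>The division is exact because
  \<open>(r choose Suc j) * Suc j = (r choose j) * (r - j)\<close>; using \<open>j - r\<close>
  instead of \<open>r - j\<close> supplies the sign change. For \<open>j = r\<close> both sides are
  0.\<close>

lemma alternating_binomial_step: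
  assumes "j \<le> r"
  shows "(-1) ^ j * int (r choose j) * (int j - int r) div (int j + 1) =
    (-1) ^ Suc j * int (r choose Suc j)"
proof -
  have "int (r choose Suc j) * (int j + 1) = int ((r choose Suc j) * Suc j)"
    by (simp add: algebra_simps)
  also have "\<dots> = int (r choose j) * (int r - int j)"
    unfolding choose_Suc_mult using assms by (simp add: of_nat_diff)
  finally have "(-1) ^ Suc j * (int (r choose Suc j) * (int j + 1)) =
      (-1) ^ Suc j * (int (r choose j) * (int r - int j))"
    by (simp only:)
  also have "\<dots> = (-1) ^ j * int (r choose j) * (int j - int r)"
    by (simp add: algebra_simps)
  finally have "(-1) ^ Suc j * (int (r choose Suc j) * (int j + 1)) =
      (-1) ^ j * int (r choose j) * (int j - int r)" .
  then have eq: "(-1) ^ j * int (r choose j) * (int j - int r) =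
      ((-1) ^ Suc j * int (r choose Suc j)) * (int j + 1)"
    by (simp only: mult.assoc)
  show ?thesis
    unfolding eq by (rule nonzero_mult_div_cancel_right) linarith
qed

text \<open>A set containing every point the program queries, used to bound the size of the
  coordinates. The order of a test is at most \<open>n + k\<close>, whence the range of
  \<open>z\<close>.\<close>

definition test_points :: "nat \<Rightarrow> nat \<Rightarrow> (nat \<Rightarrow> int) set" where
  "test_points n k = {test_point n b (int z) |b z. z \<le> n + k}"

lemma test_order_le: "test_order n k b \<le> n + k"
proof -
  have "(\<Sum>i<n. 1 - digit 2 b i) \<le> (\<Sum>i<n. 1)" by (rule sum_mono) simp
  then show ?thesis by (simp add: test_order_def)
qed

lemma wp_test_com:
  assumes "\<sigma> ''n'' 0 = int n" "\<sigma> ''k'' 0 = int k" "\<sigma> ''b'' 0 = int b"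
    and Q: "\<And>\<sigma>' qs'. agree_off test_vars \<sigma> \<sigma>' \<Longrightarrow>
      \<sigma>' ''accept'' 0 = (if diff_test n k P b \<noteq> 0 then 1 else \<sigma> ''accept'' 0) \<Longrightarrow>
      length qs' \<le> length qs + (n + k + 1) \<Longrightarrow> set qs' \<subseteq> set qs \<union> test_points n k \<Longrightarrow> Q (\<sigma>', qs')"
  shows "wp n P test_com Q (\<sigma>, qs)"
proof -
  define r where "r = test_order n k b"
  \<comment> \<open>Leaving out \<open>accept\<close> makes the loop invariant preserve the earlier
    verdict, which only the final conditional may change.\<close>
  define W where "W = test_vars - {''accept''}"
  define S where "S z = (\<Sum>j<z. (-1) ^ j * int (r choose j) * eval_mpoly P (test_point n b (int j)))" for z
  have diff_test: "diff_test n k P b = S (Suc r)"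
    by (simp add: diff_test_def S_def r_def lessThan_Suc_atMost)
  show ?thesis
    unfolding test_com_def
  proof (intro wp_Seq wp_Assign, rule wp_balance_com[where c = 0 and b = b], goal_cases)
    case (4 \<sigma>1)
    note eq1 = agree_offD[OF 4(1)]
    have r: "\<sigma>1 ''n'' 0 - \<sigma>1 ''x'' 0 + \<sigma>1 ''k'' 0 = int r"
      unfolding r_def test_order_eq_balance 4(2) by (simp add: eq1 store_upd_apply assms)
    have agree1: "agree_off W \<sigma> \<sigma>1"
      by (rule agree_off_trans[OF 4(1)])
        (simp_all add: agree_off_upd agree_off_refl W_def test_vars_def)
    show ?case
    proof (intro wp_Seq wp_Assign, rule wp_for[where m = "Suc r" and
        I = "\<lambda>z \<sigma>' qs'. agree_off W \<sigma> \<sigma>' \<and> \<sigma>' ''z'' 0 = int z \<and> \<sigma>' ''r'' 0 = int r \<and>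
          \<sigma>' ''s'' 0 = S z \<and> \<sigma>' ''u'' 0 = (-1) ^ z * int (r choose z) \<and>
          length qs' = length qs + z \<and> set qs' \<subseteq> set qs \<union> test_points n k"], goal_cases)
      case 1
      show ?case
        using agree1 r by (simp add: agree_off_upd store_upd_apply W_def test_vars_def S_def)
    next
      case (2 z \<sigma>' qs')
      have I: "agree_off W \<sigma> \<sigma>'" "\<sigma>' ''z'' 0 = int z" "\<sigma>' ''r'' 0 = int r" "\<sigma>' ''s'' 0 = S z"
        "\<sigma>' ''u'' 0 = (-1) ^ z * int (r choose z)"
        "length qs' = length qs + z" "set qs' \<subseteq> set qs \<union> test_points n k"
        using 2 by auto
      note eq = agree_offD[OF I(1)]
      show ?case
      proof (intro wp_Seq, rule wp_point_com[where b = b and z = "int z"], goal_cases)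
        case (4 \<sigma>2)
        note eq2 = agree_offD[OF 4(1)]
        have "agree_off W \<sigma> \<sigma>2"
          by (rule agree_off_trans[OF 4(1) _ I(1)]) (simp add: W_def test_vars_def)
        moreover have "z \<le> r" using 2(1) by simp
        moreover have "test_point n b (int z) \<in> test_points n k"
          using \<open>z \<le> r\<close> test_order_le[of n k b] unfolding test_points_def r_def
          by (blast intro: order_trans)
        moreover have "S (Suc z) = S z + (-1) ^ z * int (r choose z) * eval_mpoly P (test_point n b (int z))"
          by (simp add: S_def)
        ultimately show ?case
          using I(7) unfolding W_def test_vars_def
          by (intro wp_Seq wp_Assign wp_Query)
            (simp add: eq2 I(2-6) 4(2) agree_off_upd store_upd_apply alternating_binomial_step
              del: power_Suc binomial_Suc_Suc)
      qed (simp_all add: eq I W_def test_vars_def assms)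
    next
      case (3 z \<sigma>' qs')
      then show ?case by auto
    next
      case (4 \<sigma>' qs')
      have len: "length qs' \<le> length qs + (n + k + 1)"
        using 4 test_order_le[of n k b] by (simp add: r_def)
      have agree: "agree_off test_vars \<sigma> \<sigma>'"
        using 4 by (auto simp: agree_off_def W_def)
      have acc: "\<sigma>' ''accept'' 0 = \<sigma> ''accept'' 0"
        using 4 by (simp add: agree_off_def W_def test_vars_def)
      have s: "\<sigma>' ''s'' 0 = diff_test n k P b"
        using 4 diff_test by simp
      show ?case
      proof (rule wp_If, goal_cases)
        case 1
        then have "diff_test n k P b \<noteq> 0" using s by auto
        moreover have "agree_off test_vars \<sigma> (store_upd \<sigma>' ''accept'' 0 1)"
          using agree by (simp add: agree_off_upd test_vars_def)
        ultimately show ?case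
          using len 4 by (intro wp_Assign) (simp add: Q store_upd_apply)
      next
        case 2
        then have "\<not> 0 < diff_test n k P b * diff_test n k P b" using s by simp
        \<comment> \<open>The language compares only by \<open>Less\<close>; positivity of the
          square expresses being nonzero.\<close>
        then have "diff_test n k P b = 0" by (auto simp: zero_less_mult_iff not_less)
        then show ?case
          using agree len acc 4 by (intro wp_Skip Q) simp_all
      qed
    qed
  qed (simp_all add: store_upd_apply assms)
qed

definition query_com :: com where
  "query_com =
    ''h'' ::= V ''F'';; ''j'' ::= Num 0;;
    While (Less (V ''j'') (V ''N''))
     (''b'' ::= Mod (V ''h'') (V ''T'');; ''h'' ::= Div (V ''h'') (V ''T'');;
      test_com;; incr ''j'')"

lemma wp_query_com:
  assumes "\<sigma> ''n'' 0 = int n" "\<sigma> ''k'' 0 = int k" "\<sigma> ''T'' 0 = 2 ^ n"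
    "\<sigma> ''N'' 0 = int N" "\<sigma> ''F'' 0 = int F"
    and Q: "\<And>\<sigma>' qs'. agree_off (test_vars \<union> {''h'', ''j'', ''b''}) \<sigma> \<sigma>' \<Longrightarrow>
      \<sigma>' ''accept'' 0 = (if \<exists>j<N. diff_test n k P (digit (2 ^ n) F j) \<noteq> 0 then 1 else \<sigma> ''accept'' 0) \<Longrightarrow>
      length qs' \<le> length qs + N * (n + k + 1) \<Longrightarrow> set qs' \<subseteq> set qs \<union> test_points n k \<Longrightarrow> Q (\<sigma>', qs')"
  shows "wp n P query_com Q (\<sigma>, qs)"
proof -
  define u where "u j = int (F div (2 ^ n) ^ j)" for j
  define d where "d j = digit (2 ^ n) F j" for j
  define W where "W = test_vars \<union> {''h'', ''j'', ''b''}"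
  have W: "test_vars \<subseteq> W" "''h'' \<in> W" "''j'' \<in> W" "''b'' \<in> W"
    by (auto simp: W_def)
  \<comment> \<open>The verdict accumulates a disjunction: a test can set it to 1 but never resets
    it.\<close>
  define A where "A j = (if \<exists>i<j. diff_test n k P (d i) \<noteq> 0 then 1 else \<sigma> ''accept'' 0)" for j
  have u_0: "u 0 = int F" and mod: "u j mod 2 ^ n = int (d j)" and div: "u j div 2 ^ n = u (Suc j)" for j
    unfolding u_def d_def int_digit int_div_power_Suc by simp_all
  have A_Suc: "A (Suc j) = (if diff_test n k P (d j) \<noteq> 0 then 1 else A j)" for j
    by (auto simp: A_def less_Suc_eq)
  show ?thesis
    unfolding query_com_def
  proof (intro wp_Seq wp_Assign, rule wp_for[where m = N and
      I = "\<lambda>j \<sigma>' qs'. agree_off W \<sigma> \<sigma>' \<and> \<sigma>' ''j'' 0 = int j \<and> \<sigma>' ''h'' 0 = u j \<and>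
        \<sigma>' ''accept'' 0 = A j \<and>
        length qs' \<le> length qs + j * (n + k + 1) \<and> set qs' \<subseteq> set qs \<union> test_points n k"], goal_cases)
    case 1
    show ?case
      by (simp add: agree_off_upd agree_off_refl store_upd_apply W_def A_def u_0 assms)
  next
    case (2 j \<sigma>' qs')
    have I: "agree_off W \<sigma> \<sigma>'" "\<sigma>' ''j'' 0 = int j" "\<sigma>' ''h'' 0 = u j" "\<sigma>' ''accept'' 0 = A j"
      "length qs' \<le> length qs + j * (n + k + 1)" "set qs' \<subseteq> set qs \<union> test_points n k"
      using 2 by auto
    note eq = agree_offD[OF I(1)]
    show ?case
    proof (intro wp_Seq wp_Assign, rule wp_test_com[where k = k and b = "d j"], goal_cases)
      case (4 \<sigma>'' qs'')
      note eq2 = agree_offD[OF 4(1)]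
      have "agree_off W \<sigma> \<sigma>''"
        by (rule agree_off_trans[OF 4(1)]) (simp_all add: agree_off_upd I W)
      moreover have "length qs'' \<le> length qs + Suc j * (n + k + 1)"
        using 4(3) I(5) by simp
      moreover have "set qs'' \<subseteq> set qs \<union> test_points n k"
        using 4(4) I(6) by blast
      moreover have "\<sigma>'' ''accept'' 0 = A (Suc j)"
        unfolding 4(2) A_Suc by (simp add: store_upd_apply I(4))
      moreover have "\<sigma>'' ''j'' 0 = int j" "\<sigma>'' ''h'' 0 = u (Suc j)"
        by (simp_all add: eq2 store_upd_apply I(2,3) test_vars_def eq W_def assms(3) div)
      ultimately show ?case
        by (intro wp_Assign) (simp add: agree_off_upd store_upd_apply W del: mult_Suc)
    qed (simp_all add: eq store_upd_apply W_def test_vars_def I(2-4) assms(1-5) mod)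
  next
    case (3 j \<sigma>' qs')
    then show ?case using assms(4) by (auto simp: agree_off_def W_def test_vars_def)
  next
    case (4 \<sigma>' qs')
    then show ?case
      unfolding W_def A_def d_def by (intro Q) auto
  qed
qed

section \<open>Stages of decreasing density and the complete program\<close>

definition stage_com :: com where
  "stage_com =
    ''N'' ::= Times (V ''U'') (Plus (Times (V ''n'') (V ''n'')) (Num 1));;
    search_com;; query_com;;
    ''U'' ::= Times (Num 2) (V ''U'');; incr ''t''"

definition stage_vars :: "vname set" where
  "stage_vars = {''N'', ''h'', ''j'', ''b'', ''U'', ''t''} \<union> search_vars \<union> test_vars"

lemma wp_stage_com:
  assumes "\<sigma> ''n'' 0 = int n" "\<sigma> ''k'' 0 = int k" "\<sigma> ''T'' 0 = 2 ^ n" "\<sigma> ''D'' 0 = int ((n + 1) ^ n)"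
    "\<sigma> ''U'' 0 = 2 ^ w"
    and Q: "\<And>\<sigma>' qs' F. agree_off stage_vars \<sigma> \<sigma>' \<Longrightarrow>
      hitting_family n k w F \<Longrightarrow>
      \<sigma>' ''U'' 0 = 2 ^ Suc w \<Longrightarrow> \<sigma>' ''t'' 0 = \<sigma> ''t'' 0 + 1 \<Longrightarrow>
      \<sigma>' ''accept'' 0 = (if \<exists>j<family_size n w. diff_test n k P (digit (2 ^ n) F j) \<noteq> 0
        then 1 else \<sigma> ''accept'' 0) \<Longrightarrow>
      length qs' \<le> length qs + family_size n w * (n + k + 1) \<Longrightarrow>
      set qs' \<subseteq> set qs \<union> test_points n k \<Longrightarrow> Q (\<sigma>', qs')"
  shows "wp n P stage_com Q (\<sigma>, qs)"
  unfolding stage_com_def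
proof (intro wp_Seq wp_Assign, rule wp_search_com[where k = k and w = w], goal_cases)
  case (7 \<sigma>1 F)
  note eq1 = agree_offD[OF 7(1)]
  show ?case
  proof (intro wp_Seq, rule wp_query_com[where k = k and N = "family_size n w" and F = F], goal_cases)
    case (6 \<sigma>2 qs2)
    note eq2 = agree_offD[OF 6(1)]
    have "agree_off stage_vars \<sigma> \<sigma>1"
      by (rule agree_off_trans[OF 7(1)]) (auto simp: agree_off_upd agree_off_refl stage_vars_def)
    then have agree2: "agree_off stage_vars \<sigma> \<sigma>2"
      by (rule agree_off_trans[OF 6(1), rotated]) (auto simp: stage_vars_def)
    have U: "\<sigma>2 ''U'' 0 = 2 ^ w" "\<sigma>2 ''t'' 0 = \<sigma> ''t'' 0"
      by (simp_all add: eq2 eq1 store_upd_apply test_vars_def search_vars_def assms)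
    have acc: "\<sigma>2 ''accept'' 0 = (if \<exists>j<family_size n w. diff_test n k P (digit (2 ^ n) F j) \<noteq> 0
        then 1 else \<sigma> ''accept'' 0)"
    proof -
      have "\<sigma>1 ''accept'' 0 = \<sigma> ''accept'' 0"
        by (simp add: eq1 store_upd_apply search_vars_def)
      then show ?thesis unfolding 6(2) by (simp only:)
    qed
    show ?case
    proof (intro wp_Seq wp_Assign, rule Q[where F = F], goal_cases)
      case 5
      show ?case unfolding acc[symmetric] by (simp add: store_upd_apply)
    qed (use agree2 6(3,4) in
        \<open>simp_all add: U 7(3) agree_off_upd store_upd_apply stage_vars_def\<close>)
  qed (simp_all add: eq1 store_upd_apply search_vars_def assms 7(2) family_size_def distrib_left)
qed (simp_all add: store_upd_apply assms family_size_def distrib_left)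

text \<open>The guard settles \<open>n < k\<close>, where no monomial qualifies. Otherwise
  \<open>k \<le> n\<close> bounds the cost \<open>n + k + 1\<close> of a test by
  \<open>2 * n + 1\<close>. \<open>U\<close> starts at \<open>2 ^ (k + 1)\<close>, the inverse
  density for \<open>t = 0\<close>, and doubles in each stage.\<close>

definition algorithm :: com where
  "algorithm =
    If (Less (V ''n'') (V ''k'')) Skip
     (power_com ''T'' (Num 2) (V ''n'');;
      power_com ''D'' (Plus (V ''n'') (Num 1)) (V ''n'');;
      power_com ''U'' (Num 2) (Plus (V ''k'') (Num 1));;
      ''t'' ::= Num 0;;
      While (And (Less (V ''t'') (Plus (V ''k'') (Num 1))) (Less (V ''accept'') (Num 1))) stage_com)"

text \<open>With \<open>s = DV_s n k P\<close>, the factor \<open>4 * 2 ^ (k + s)\<close> is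
  \<open>2 ^ (k + 1) * 2 ^ (s + 1)\<close>, a bound for the geometric sum of the stage costs. The
  coordinate bound is generous; what matters is a bit length polynomial in \<open>n\<close>.\<close>

definition correct_outcome :: "nat \<Rightarrow> nat \<Rightarrow> int_mpoly \<Rightarrow> config \<Rightarrow> bool" where
  "correct_outcome n k P = (\<lambda>(\<sigma>, qs). (\<sigma> ''accept'' 0 \<noteq> 0 \<longleftrightarrow> DV n k P) \<and>
    length qs \<le> 4 * (n * n + 1) * (2 * n + 1) * 2 ^ (k + DV_s n k P) \<and>
    (\<forall>y\<in>set qs. \<forall>i<n. \<bar>y i\<bar> \<le> 2 ^ (2 * n)))"

lemma test_points_bound:
  assumes "y \<in> test_points n k" "k \<le> n"
  shows "\<bar>y i\<bar> \<le> 2 ^ (2 * n)"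
proof -
  obtain b z where y: "y = test_point n b (int z)" and "z \<le> 2 * n"
    using assms by (auto simp: test_points_def)
  then have "z < 2 ^ (2 * n)"
    using less_exp[of "2 * n"] by linarith
  then have "int z \<le> 2 ^ (2 * n)"
    by (metis less_imp_le of_nat_le_iff of_nat_numeral of_nat_power)
  then show ?thesis
    by (auto simp: y test_point_def digit_2)
qed

lemma wp_algorithm:
  assumes P: "DV_instance n P"
  shows "wp n P algorithm (correct_outcome n k P) (initial_store n k, [])"
  unfolding algorithm_def
proof (rule wp_If, goal_cases)
  case 1
  then have "n < k" by (simp add: initial_store_def store_upd_apply)
  then have "\<not> DV n k P" by (auto simp: DV_def DV_monomials_def)
  then show ?case
    by (intro wp_Skip) (simp add: correct_outcome_def initial_store_def store_upd_apply)
next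
  case 2
  then have "k \<le> n" by (simp add: initial_store_def store_upd_apply)
  define s where "s = DV_s n k P"
  \<comment> \<open>Stage \<open>t\<close> makes at most \<open>C * 2 ^ t\<close> queries, so the
    total before stage \<open>t\<close> also stays below \<open>C * 2 ^ t\<close>, as recorded in
    \<open>J\<close>.\<close>
  define C where "C = 2 ^ (k + 1) * (n * n + 1) * (2 * n + 1)"
  define J where "J \<sigma> qs t \<longleftrightarrow> \<sigma> ''n'' 0 = int n \<and> \<sigma> ''k'' 0 = int k \<and> \<sigma> ''T'' 0 = 2 ^ n \<and>
    \<sigma> ''D'' 0 = int ((n + 1) ^ n) \<and> \<sigma> ''U'' 0 = 2 ^ (k + t + 1) \<and> \<sigma> ''t'' 0 = int t \<and>
    \<sigma> ''accept'' 0 \<in> {0, 1} \<and> (\<sigma> ''accept'' 0 = 1 \<longrightarrow> DV n k P) \<and>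
    (DV n k P \<and> t = s + 1 \<longrightarrow> \<sigma> ''accept'' 0 = 1) \<and>
    t \<le> s + 1 \<and> length qs \<le> C * 2 ^ t \<and> set qs \<subseteq> test_points n k" for \<sigma> :: store and qs t
  have s: "s \<le> k" "\<not> DV n k P \<Longrightarrow> s = k"
    unfolding s_def by (simp_all add: DV_s_le DV_s_negative)
  let ?R = "inv_image less_than (\<lambda>(\<sigma>, qs :: (nat \<Rightarrow> int) list). nat (int k + 1 - \<sigma> ''t'' 0))"
  let ?I = "\<lambda>(\<sigma>, qs). \<exists>t. J \<sigma> qs t"
  have loop: "wp n P (While (And (Less (V ''t'') (Plus (V ''k'') (Num 1))) (Less (V ''accept'') (Num 1))) stage_com)
      (correct_outcome n k P) (\<sigma>, [])" if "J \<sigma> [] 0" for \<sigma>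
  proof (rule wp_While[where R = ?R and I = ?I], goal_cases)
    case 1
    show ?case by (intro wf_inv_image wf_less_than)
  next
    case 2
    show ?case using that by auto
  next
    case (3 cfg)
    obtain \<sigma> qs where cfg: "cfg = (\<sigma>, qs)" by (cases cfg)
    have "\<exists>t. J \<sigma> qs t" using 3(1) unfolding cfg prod.case .
    then obtain t where t: "J \<sigma> qs t" by blast
    then have J: "\<sigma> ''n'' 0 = int n" "\<sigma> ''k'' 0 = int k" "\<sigma> ''T'' 0 = 2 ^ n"
      "\<sigma> ''D'' 0 = int ((n + 1) ^ n)" "\<sigma> ''U'' 0 = 2 ^ (k + t + 1)" "\<sigma> ''t'' 0 = int t"
      "\<sigma> ''accept'' 0 \<in> {0, 1}" "\<sigma> ''accept'' 0 = 1 \<Longrightarrow> DV n k P"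
      "DV n k P \<Longrightarrow> t = s + 1 \<Longrightarrow> \<sigma> ''accept'' 0 = 1"
      "t \<le> s + 1" "length qs \<le> C * 2 ^ t" "set qs \<subseteq> test_points n k"
      unfolding J_def by blast+
    have "t \<le> k" and acc0: "\<sigma> ''accept'' 0 = 0"
      using 3(2) J(2,6,7) by (auto simp: cfg)
    \<comment> \<open>A positive instance would have been accepted after stage \<open>s\<close>; a
      negative one has \<open>s = k\<close>, which \<open>t\<close> has not passed.\<close>
    have "t \<noteq> s + 1"
      using J(9) \<open>t \<le> k\<close> acc0 s by (cases "DV n k P") auto
    then have "t \<le> s" using J(10) by linarith
    show ?case
      unfolding cfg
    proof (rule wp_stage_com[where k = k and w = "k + t + 1"], goal_cases)
      case (6 \<sigma>' qs' F)
      note eq = agree_offD[OF 6(1)]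
      let ?hit = "\<exists>j<family_size n (k + t + 1). diff_test n k P (digit (2 ^ n) F j) \<noteq> 0"
      have acc: "\<sigma>' ''accept'' 0 = (if ?hit then 1 else 0)"
        using 6(5) acc0 by simp
      have "DV n k P" if ?hit
        using that DV_if_balanced P unfolding diff_test_nonzero_iff[OF P] DV_instance_def by blast
      \<comment> \<open>At \<open>t = s\<close> the density threshold of the stage is the one
        guaranteed for an optimal monomial, so the family cannot miss it.\<close>
      moreover have ?hit if "DV n k P" "t = s"
        using hitting_family_detects[OF P that(1), of "k + t + 1" "family_size n (k + t + 1)" F]
          6(2) that(2)
        unfolding hitting_family_def diff_test_nonzero_iff[OF P] s_def by simp
      moreover have "length qs' \<le> C * 2 ^ (t + 1)"
      proof -
        have "family_size n (k + t + 1) * (n + k + 1) \<le> family_size n (k + t + 1) * (2 * n + 1)"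
          using \<open>k \<le> n\<close> by (intro mult_left_mono) auto
        also have "\<dots> = C * 2 ^ t"
          by (simp add: family_size_def C_def power_add algebra_simps)
        finally show ?thesis using 6(6) J(11) by simp
      qed
      moreover have "set qs' \<subseteq> test_points n k" using 6(7) J(12) by blast
      moreover have "\<sigma>' ''n'' 0 = int n" "\<sigma>' ''k'' 0 = int k" "\<sigma>' ''T'' 0 = 2 ^ n"
        "\<sigma>' ''D'' 0 = int ((n + 1) ^ n)"
        using J(1-4) by (simp_all add: eq stage_vars_def search_vars_def test_vars_def)
      ultimately have "J \<sigma>' qs' (t + 1)"
        using 6(3,4) J(6) \<open>t \<le> s\<close> acc unfolding J_def by (auto simp: acc)
      moreover have "((\<sigma>', qs'), (\<sigma>, qs)) \<in> ?R"
        using 6(4) J(6) \<open>t \<le> k\<close> by simp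
      ultimately show ?case by auto
    qed (fact J)+
  next
    case (4 cfg)
    obtain \<sigma> qs where cfg: "cfg = (\<sigma>, qs)" by (cases cfg)
    have "\<exists>t. J \<sigma> qs t" using 4(1) unfolding cfg prod.case .
    then obtain t where t: "J \<sigma> qs t" by blast
    then have J: "\<sigma> ''k'' 0 = int k" "\<sigma> ''t'' 0 = int t"
      "\<sigma> ''accept'' 0 \<in> {0, 1}" "\<sigma> ''accept'' 0 = 1 \<Longrightarrow> DV n k P"
      "DV n k P \<Longrightarrow> t = s + 1 \<Longrightarrow> \<sigma> ''accept'' 0 = 1"
      "t \<le> s + 1" "length qs \<le> C * 2 ^ t" "set qs \<subseteq> test_points n k"
      unfolding J_def by blast+
    have "\<sigma> ''accept'' 0 = 1" if "DV n k P"
    proof (rule ccontr)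
      assume "\<sigma> ''accept'' 0 \<noteq> 1"
      \<comment> \<open>The loop ended without acceptance, so all stages up to \<open>k\<close> are
        done, among them stage \<open>s\<close>.\<close>
      then have "k < t" using 4(2) J(1-3) by (auto simp: cfg)
      then have "t = s + 1" using J(6) s(1) by linarith
      then show False using J(5) that \<open>\<sigma> ''accept'' 0 \<noteq> 1\<close> by blast
    qed
    then have "\<sigma> ''accept'' 0 \<noteq> 0 \<longleftrightarrow> DV n k P"
      using J(3,4) by auto
    moreover have "C * 2 ^ t \<le> C * 2 ^ (s + 1)"
      using J(6) by (intro mult_left_mono power_increasing) auto
    then have "length qs \<le> 4 * (n * n + 1) * (2 * n + 1) * 2 ^ (k + s)"
      using J(7) by (simp add: C_def power_add algebra_simps)
    moreover have "\<forall>y\<in>set qs. \<forall>i<n. \<bar>y i\<bar> \<le> 2 ^ (2 * n)"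
      using J(8) test_points_bound[OF _ \<open>k \<le> n\<close>] by blast
    ultimately show ?case by (simp add: correct_outcome_def cfg s_def)
  qed
  let ?\<sigma> = "initial_store n k"
  have init: "?\<sigma> ''n'' 0 = int n" "?\<sigma> ''k'' 0 = int k" "?\<sigma> ''accept'' 0 = 0"
    by (simp_all add: initial_store_def store_upd_apply)
  show ?case
  proof (intro wp_Seq, rule wp_power_com[where b' = 2 and m' = n], goal_cases)
    case (3 \<sigma>1)
    note eq1 = agree_offD[OF 3(1)]
    show ?case
    proof (intro wp_Seq, rule wp_power_com[where b' = "n + 1" and m' = n], goal_cases)
      case (3 \<sigma>2)
      note eq2 = agree_offD[OF 3(1)]
      show ?case
      proof (intro wp_Seq, rule wp_power_com[where b' = 2 and m' = "k + 1"], goal_cases)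
        case (3 \<sigma>3)
        note eq3 = agree_offD[OF 3(1)]
        have "J (store_upd \<sigma>3 ''t'' 0 0) [] 0"
          using \<open>\<sigma>1 ''T'' 0 = int (2 ^ n)\<close> \<open>\<sigma>2 ''D'' 0 = int ((n + 1) ^ n)\<close> 3(2)
          unfolding J_def
          by (simp add: store_upd_apply eq3 eq2 eq1 init s del: power_Suc of_nat_power)
        then show ?case by (intro wp_Seq wp_Assign) (simp add: loop)
      qed (auto simp: agree_off_def eq2 eq1 init)
    qed (auto simp: agree_off_def eq1 init)
  qed (auto simp: agree_off_def init)
qed

theorem theorem5:
  shows "\<exists>(A :: com) (p :: nat poly) (q :: nat poly) (\<epsilon> :: nat \<Rightarrow> real).
    \<epsilon> \<longlonglongrightarrow> 0 \<and>
    (\<forall>(n :: nat) (k :: nat) (P :: int_mpoly). DV_instance n P \<longrightarrow>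
      lossless_spmf (run A n k P) \<and>
      (\<forall>(accepted, qs) \<in> set_spmf (run A n k P).
        length qs \<le> poly p n * 2 ^ (k + DV_s n k P) \<and>
        (\<forall>y \<in> set qs. \<forall>i < n. \<bar>y i\<bar> \<le> 2 ^ poly q n) \<and>
        (accepted \<longrightarrow> DV n k P)) \<and>
      (DV n k P \<longrightarrow> spmf (map_spmf fst (run A n k P)) False \<le> \<epsilon> n))"
proof (intro exI conjI allI impI)
  let ?p = "[:4:] * ([:0, 1:] * [:0, 1:] + 1) * ([:0, 2:] + 1) :: nat poly"
  let ?q = "[:0, 2:] :: nat poly"
  have p: "poly ?p n = 4 * (n * n + 1) * (2 * n + 1)" and q: "poly ?q n = 2 * n" for n
    by (simp_all add: algebra_simps)
  \<comment> \<open>The outcome is a point mass with the correct verdict, so the error bound can be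
    identically 0.\<close>
  show "(\<lambda>_. 0 :: real) \<longlonglongrightarrow> 0" by simp
  fix n k P assume P: "DV_instance n P"
  obtain \<sigma> qs where exec: "exec n P algorithm (initial_store n k, []) = return_spmf (\<sigma>, qs)"
    and correct: "correct_outcome n k P (\<sigma>, qs)"
    using wp_algorithm[OF P, of k] unfolding wp_def by (metis surj_pair)
  have run: "run algorithm n k P = return_spmf (DV n k P, qs)"
    using correct unfolding run_def exec by (simp add: correct_outcome_def)
  show "lossless_spmf (run algorithm n k P)" by (simp add: run)
  show "\<forall>(accepted, qs) \<in> set_spmf (run algorithm n k P).
      length qs \<le> poly ?p n * 2 ^ (k + DV_s n k P) \<and>
      (\<forall>y \<in> set qs. \<forall>i < n. \<bar>y i\<bar> \<le> 2 ^ poly ?q n) \<and> (accepted \<longrightarrow> DV n k P)"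
    using correct unfolding p q by (simp add: run correct_outcome_def)
  show "spmf (map_spmf fst (run algorithm n k P)) False \<le> 0" if "DV n k P"
    using that by (simp add: run)
qed

end
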